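(* Let $(\mathcal{F}_t)_{t\ge0}$ be a filtration, $\theta^*\in\mathbb{R}^d$ a fixed vector, $(X_t)_{t\ge1}$ an $\mathbb{R}^d$-valued $(\mathcal{F}_t)$-predictable sequence ($X_t$ is $\mathcal{F}_{t-1}$-measurable), $(\epsilon_t)_{t\ge1}$ a real-valued $(\mathcal{F}_t)$-adapted sequence, and $Y_t=\langle X_t,\theta^*\rangle+\epsilon_t$ for $t\ge1$. Let $S_t:=\sum_{s=1}^t\epsilon_sX_s$ and $V_t:=\sum_{s=1}^tX_sX_s^\top$, and assume that $(S_t)_{t\ge0}$ is sub-$\psi$ with variance proxy $(V_t)_{t\ge0}$ with respect to $(\mathcal{F}_t)$, where $\psi:[0,\lambda_{\max})\to[0,\infty)$ is a super-Gaussian CGF-like function with $\lim_{\lambda\uparrow\lambda_{\max}}\psi'(\lambda)=\infty$. Let $\rho>0$, and for $t\ge1$ let $$\widehat\theta_t:=(V_t\lor\rho I_d)^{-1}\sum_{s=1}^tY_sX_s,\qquad\widetilde\theta_t:=(V_t+\rho I_d)^{-1}\sum_{s=1}^tY_sX_s.$$ Let $\alpha>1$, $\beta>1$, $\epsilon\in(0,1)$, $\delta\in(0,1)$, and let $h:[0,\infty)\to(0,\infty)$ be increasing with $\sum_{k=0}^\infty h(k)^{-1}\le1$. For a positive semi-definite $d\times d$ matrix $V$ put $$L_\rho(V):=\log\left(h\left(\log_\alpha\left(\frac{\gamma_{\max}(V\lor\rho I_d)}{\rho}\right)\right)\right)+\log\left(\frac1\delta\cdot\frac{1}{1-\beta^{-1}}\right)+\log\left(\beta\sqrt{\kappa(V\lor\rho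 I_d)}\cdot N_{d-1}\left(\frac{\epsilon}{\beta\sqrt{\kappa(V\lor\rho I_d)}}\right)\right).$$ Then: (1) with probability at least $1-\delta$, simultaneously for all $t\ge1$, $$\|(V_t\lor\rho I_d)^{1/2}(\widehat\theta_t-\theta^* )\|<\frac{\sqrt{\gamma_{\min}(V_t\lor\rho I_d)}}{1-\epsilon}\cdot(\psi^* )^{-1}\left(\frac{\alpha}{\gamma_{\min}(V_t\lor\rho I_d)}L_\rho(V_t)\right)+\sqrt\rho\,\|\theta^*\|\,\mathbf{1}_{\gamma_{\min}(V_t)<\rho};$$ (2) with probability at least $1-\delta$, simultaneously for all $t\ge1$, $$\|(V_t+\rho I_d)^{1/2}(\widetilde\theta_t-\theta^* )\|<\frac{\sqrt{\gamma_{\min}(V_t+\rho I_d)}}{1-\epsilon}\cdot(\psi^* )^{-1}\left(\frac{\alpha}{\gamma_{\min}(V_t+\rho I_d)}L_\rho(V_t+\rho I_d)\right)+\sqrt\rho\,\|\theta^*\|.$$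
   Context: $\|\cdot\|$ and $\langle\cdot,\cdot\rangle$ are the Euclidean norm and inner product; $\mathbb{S}^{d-1}$ is the Euclidean unit sphere in $\mathbb{R}^d$; $a\lor b=\max\{a,b\}$. Matrices: for a $d\times d$ symmetric positive semi-definite $V$, $\gamma_{\max}(V),\gamma_{\min}(V)$ are its largest and smallest eigenvalues and $\kappa(V)=\gamma_{\max}(V)/\gamma_{\min}(V)$. If $V=\sum_n\gamma_n v_nv_n^\top$ is a spectral decomposition with orthonormal eigenvectors, $V\lor\rho I_d:=\sum_n(\gamma_n\lor\rho)v_nv_n^\top$. Covering number: $N_{d-1}(\epsilon)$ is the smallest cardinality of a set $K\subset\mathbb{S}^{d-1}$ such that every $x\in\mathbb{S}^{d-1}$ has some $y\in K$ with $\|x-y\|\le\epsilon$. CGF-like: for $\lambda_{\max}\in(0,\infty]$, a twice continuously differentiable function $\psi:[0,\lambda_{\max})\to[0,\infty)$ is CGF-like if it is strictly convex, $\psi(0)=\psi'(0)=0$ and $\psi''(0)>0$. It is super-Gaussian if $\psi(\lambda)/\lambda^2$ is non-decreasing in $\lambda$. Convex conjugate: $\psi^*(u)=\sup_{\lambda\in[0,\lambda_{\max})}(u\lambda-\psi(\lambda))$ for $u\in[0,\infty)$ (when $\lim_{\lambda\uparrow\lambda_{\max}}\psi'(\lambda)=\infty$); it is a strictly increasing bijection of $[0,\infty)$ and $(\psi^* )^{-1}$ is its inverse. Sub-$\psi$ (vector): let $(S_t)_{t\ge0}$ be $\mathbb{R}^d$-valued and $(V_t)_{t\ge0}$ be valued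 in $d\times d$ positive semi-definite matrices, both adapted to a filtration $(\mathcal{F}_t)_{t\ge0}$. $(S_t)$ is sub-$\psi$ with variance proxy $(V_t)$ if for every $\nu\in\mathbb{S}^{d-1}$ and $\lambda\in[0,\lambda_{\max})$ there is a non-negative supermartingale $(L_t)_{t\ge0}$ with respect to $(\mathcal{F}_t)$ with $\mathbb{E}[L_0]\le1$ such that almost surely $\exp\{\lambda\langle\nu,S_t\rangle-\psi(\lambda)\langle\nu,V_t\nu\rangle\}\le L_t$ for all $t\ge0$. *)

theory Defs
  imports "HOL-Probability.Probability"
begin

section \<open>Symmetric matrices\<close>

definition outer_sq :: "real^'n \<Rightarrow> real^'n^'n" where
  "outer_sq v = (\<chi> i j. v $ i * v $ j)"

definition psd :: "real^'n^'n \<Rightarrow> bool" where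
  "psd V \<longleftrightarrow> transpose V = V \<and> (\<forall>x. 0 \<le> x \<bullet> (V *v x))"

definition eigenvalues :: "real^'n^'n \<Rightarrow> real set" where
  "eigenvalues V = {c. \<exists>x. x \<noteq> 0 \<and> V *v x = c *\<^sub>R x}"

definition eig_max :: "real^'n^'n \<Rightarrow> real" where
  "eig_max V = Max (eigenvalues V)"

definition eig_min :: "real^'n^'n \<Rightarrow> real" where
  "eig_min V = Min (eigenvalues V)"

definition cond_number :: "real^'n^'n \<Rightarrow> real" where
  "cond_number V = eig_max V / eig_min V"

definition spectral_decomposition ::
    "real^'n^'n \<Rightarrow> ('n \<Rightarrow> real) \<Rightarrow> ('n \<Rightarrow> real^'n) \<Rightarrow> bool" where
  "spectral_decomposition V c v \<longleftrightarrow>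
     (\<forall>i j. v i \<bullet> v j = (if i = j then 1 else 0)) \<and>
     V = (\<Sum>i\<in>UNIV. c i *\<^sub>R outer_sq (v i))"

text \<open>Functional calculus. The matrix described by the definite description exists for symmetric
  \<open>V\<close> and does not depend on the choice of the spectral decomposition.\<close>

definition spectral_map :: "(real \<Rightarrow> real) \<Rightarrow> real^'n^'n \<Rightarrow> real^'n^'n" where
  "spectral_map f V =
     (THE W. \<exists>c v. spectral_decomposition V c v \<and> W = (\<Sum>i\<in>UNIV. f (c i) *\<^sub>R outer_sq (v i)))"

definition mat_max :: "real^'n^'n \<Rightarrow> real \<Rightarrow> real^'n^'n" where
  "mat_max V \<rho> = spectral_map (\<lambda>c. max c \<rho>) V"

definition mat_sqrt :: "real^'n^'n \<Rightarrow> real^'n^'n" where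
  "mat_sqrt V = spectral_map sqrt V"


section \<open>Covering numbers\<close>

text \<open>Centres are required to lie in the set \<open>S\<close> itself.\<close>

definition covering_number :: "'a::metric_space set \<Rightarrow> real \<Rightarrow> nat" where
  "covering_number S \<epsilon> =
     (LEAST n. \<exists>K. finite K \<and> card K = n \<and> K \<subseteq> S \<and> (\<forall>x\<in>S. \<exists>y\<in>K. dist x y \<le> \<epsilon>))"


section \<open>CGF-like functions\<close>

text \<open>The interval \<open>[0, \<lambda>\<^sub>m\<^sub>a\<^sub>x)\<close>, where the right endpoint may be infinite. A function on this
  interval is represented by a total function whose values outside are irrelevant.\<close>

definition cgf_dom :: "ereal \<Rightarrow> real set" where
  "cgf_dom lmax = {l. 0 \<le> l \<and> ereal l < lmax}"

definition strictly_convex_on :: "real set \<Rightarrow> (real \<Rightarrow> real) \<Rightarrow> bool" where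
  "strictly_convex_on S f \<longleftrightarrow> convex S \<and>
     (\<forall>x\<in>S. \<forall>y\<in>S. \<forall>u. x \<noteq> y \<longrightarrow> 0 < u \<longrightarrow> u < 1 \<longrightarrow>
        f (u * x + (1 - u) * y) < u * f x + (1 - u) * f y)"

text \<open>Derivatives are taken within the interval, hence are one-sided at \<open>0\<close>.\<close>

definition cgf_like :: "ereal \<Rightarrow> (real \<Rightarrow> real) \<Rightarrow> bool" where
  "cgf_like lmax \<psi> \<longleftrightarrow>
     0 < lmax \<and>
     (\<forall>l\<in>cgf_dom lmax. 0 \<le> \<psi> l) \<and>
     strictly_convex_on (cgf_dom lmax) \<psi> \<and>
     \<psi> 0 = 0 \<and>
     (\<exists>\<psi>' \<psi>''.
        (\<forall>l\<in>cgf_dom lmax. (\<psi> has_real_derivative \<psi>' l) (at l within cgf_dom lmax)) \<and>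
        (\<forall>l\<in>cgf_dom lmax. (\<psi>' has_real_derivative \<psi>'' l) (at l within cgf_dom lmax)) \<and>
        continuous_on (cgf_dom lmax) \<psi>'' \<and>
        \<psi>' 0 = 0 \<and> 0 < \<psi>'' 0)"

definition super_gaussian :: "ereal \<Rightarrow> (real \<Rightarrow> real) \<Rightarrow> bool" where
  "super_gaussian lmax \<psi> \<longleftrightarrow> mono_on (cgf_dom lmax - {0}) (\<lambda>l. \<psi> l / l\<^sup>2)"

text \<open>The limit of \<open>\<psi>'\<close> at the right endpoint is infinite; taking the left limit in \<^typ>\<open>ereal\<close>
  treats finite and infinite endpoints alike.\<close>

definition steep :: "ereal \<Rightarrow> (real \<Rightarrow> real) \<Rightarrow> bool" where
  "steep lmax \<psi> \<longleftrightarrow> filterlim (\<lambda>x. deriv \<psi> (real_of_ereal x)) at_top (at_left lmax)"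

text \<open>For a steep CGF-like \<open>\<psi>\<close> the supremum is over a set that is bounded above.\<close>

definition convex_conj :: "ereal \<Rightarrow> (real \<Rightarrow> real) \<Rightarrow> real \<Rightarrow> real" where
  "convex_conj lmax \<psi> u = (SUP l\<in>cgf_dom lmax. u * l - \<psi> l)"

definition convex_conj_inv :: "ereal \<Rightarrow> (real \<Rightarrow> real) \<Rightarrow> real \<Rightarrow> real" where
  "convex_conj_inv lmax \<psi> = inv_into {0..} (convex_conj lmax \<psi>)"


section \<open>Sub-\<open>\<psi>\<close> processes\<close>

definition supermartingale ::
    "'a measure \<Rightarrow> (nat \<Rightarrow> 'a measure) \<Rightarrow> (nat \<Rightarrow> 'a \<Rightarrow> real) \<Rightarrow> bool" where
  "supermartingale M F L \<longleftrightarrow>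
     (\<forall>t. L t \<in> borel_measurable (F t)) \<and>
     (\<forall>t. integrable M (L t)) \<and>
     (\<forall>s t. s \<le> t \<longrightarrow> (AE \<omega> in M. real_cond_exp M (F s) (L t) \<omega> \<le> L s \<omega>))"

definition sub_psi ::
    "'a measure \<Rightarrow> (nat \<Rightarrow> 'a measure) \<Rightarrow> ereal \<Rightarrow> (real \<Rightarrow> real)
     \<Rightarrow> (nat \<Rightarrow> 'a \<Rightarrow> real^'n) \<Rightarrow> (nat \<Rightarrow> 'a \<Rightarrow> real^'n^'n) \<Rightarrow> bool" where
  "sub_psi M F lmax \<psi> S V \<longleftrightarrow>
     (\<forall>t. S t \<in> borel_measurable (F t)) \<and>
     (\<forall>t. V t \<in> borel_measurable (F t)) \<and>
     (\<forall>t. \<forall>\<omega>\<in>space M. psd (V t \<omega>)) \<and>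
     (\<forall>\<nu>\<in>sphere 0 1. \<forall>l\<in>cgf_dom lmax.
        \<exists>L. supermartingale M F L \<and>
            (\<forall>t. \<forall>\<omega>\<in>space M. 0 \<le> L t \<omega>) \<and>
            (\<integral>\<omega>. L 0 \<omega> \<partial>M) \<le> 1 \<and>
            (AE \<omega> in M. \<forall>t. exp (l * (\<nu> \<bullet> S t \<omega>) - \<psi> l * (\<nu> \<bullet> (V t \<omega> *v \<nu>))) \<le> L t \<omega>))"


section \<open>Linear regression\<close>

definition weighted_sum ::
    "(nat \<Rightarrow> 'a \<Rightarrow> real) \<Rightarrow> (nat \<Rightarrow> 'a \<Rightarrow> real^'n) \<Rightarrow> nat \<Rightarrow> 'a \<Rightarrow> real^'n" where
  "weighted_sum a X t \<omega> = (\<Sum>s=1..t. a s \<omega> *\<^sub>R X s \<omega>)"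

definition gram :: "(nat \<Rightarrow> 'a \<Rightarrow> real^'n) \<Rightarrow> nat \<Rightarrow> 'a \<Rightarrow> real^'n^'n" where
  "gram X t \<omega> = (\<Sum>s=1..t. outer_sq (X s \<omega>))"

definition theta_hat ::
    "real \<Rightarrow> (nat \<Rightarrow> 'a \<Rightarrow> real^'n) \<Rightarrow> (nat \<Rightarrow> 'a \<Rightarrow> real) \<Rightarrow> nat \<Rightarrow> 'a \<Rightarrow> real^'n" where
  "theta_hat \<rho> X Y t \<omega> = matrix_inv (mat_max (gram X t \<omega>) \<rho>) *v weighted_sum Y X t \<omega>"

definition theta_tilde ::
    "real \<Rightarrow> (nat \<Rightarrow> 'a \<Rightarrow> real^'n) \<Rightarrow> (nat \<Rightarrow> 'a \<Rightarrow> real) \<Rightarrow> nat \<Rightarrow> 'a \<Rightarrow> real^'n" where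
  "theta_tilde \<rho> X Y t \<omega> = matrix_inv (gram X t \<omega> + \<rho> *\<^sub>R mat 1) *v weighted_sum Y X t \<omega>"

definition log_term ::
    "real \<Rightarrow> real \<Rightarrow> real \<Rightarrow> real \<Rightarrow> real \<Rightarrow> (real \<Rightarrow> real) \<Rightarrow> real^'n^'n \<Rightarrow> real" where
  "log_term \<rho> \<alpha> \<beta> \<epsilon> \<delta> h V =
     ln (h (log \<alpha> (eig_max (mat_max V \<rho>) / \<rho>)))
     + ln (1 / \<delta> * (1 / (1 - inverse \<beta>)))
     + ln (\<beta> * sqrt (cond_number (mat_max V \<rho>))
           * real (covering_number (sphere (0 :: real^'n) 1)
               (\<epsilon> / (\<beta> * sqrt (cond_number (mat_max V \<rho>))))))"

end

theory Submission
  imports Defs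
begin

text \<open>The proof tests the noise process \<open>S\<close> in finitely many directions at a time and exploits that all
  regularizations of \<open>V\<close> can share these tests.

  For a unit vector \<open>\<nu>\<close> and a parameter \<open>l\<close>, Ville's inequality (\<open>ville_inequality\<close>) bounds
  \<open>l (\<nu> \<bullet> S\<^sub>t) - \<psi>(l) (\<nu> \<bullet> V\<^sub>t \<nu>)\<close> for all times at once, outside an event of prescribed probability. Let \<open>A\<close> be
  a symmetric matrix above both \<open>V\<^sub>t\<close> and \<open>\<rho> I\<close>. The best \<open>l\<close> depends on the variance \<open>a = \<nu> \<bullet> A \<nu>\<close>, which is
  random; so \<open>[\<rho>, \<infinity>)\<close> is cut into epochs \<open>[\<rho> \<alpha>\<^sup>j, \<rho> \<alpha>\<^sup>j\<^sup>+\<^sup>1)\<close>, with one parameter tuned to each of them. Because \<open>\<psi>\<close>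
  is super-Gaussian, \<open>(\<psi>\<^sup>*)\<^sup>-\<^sup>1\<close> grows at least like a square root, and this bounds both the loss within an
  epoch and the loss from replacing \<open>a\<close> by the smallest eigenvalue of \<open>A\<close> (\<open>stitched_bound\<close>).

  The self-normalized quantity \<open>sqrt (S \<bullet> A\<^sup>-\<^sup>1 S)\<close> is the largest value of \<open>(\<nu> \<bullet> S) / sqrt (\<nu> \<bullet> A \<nu>)\<close>. A direction at
  distance \<open>\<epsilon> / sqrt \<kappa>(A)\<close> from the optimal one attains the fraction \<open>1 - \<epsilon>\<close> of it
  (\<open>near_optimal_direction\<close>). The condition number is again random, so nets of mesh \<open>\<epsilon> / \<beta>\<^sup>k\<close> are used for all
  \<open>k\<close>. The three terms of the confidence level are the price of the union bound over the epochs, then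
  \<open>\<delta>\<close> together with the normalization of the geometric weights \<open>\<beta>\<^sup>-\<^sup>k\<close> of the nets, and finally the reciprocal weight
  and the number of directions of the net in use (\<open>direction_bound\<close>, \<open>self_normalized_bound\<close>).

  Both estimators are \<open>A\<^sup>-\<^sup>1 (V \<theta> + S)\<close>, with \<open>A = V \<or> \<rho> I\<close> and \<open>A = V + \<rho> I\<close> respectively, so their errors are
  \<open>A\<^sup>-\<^sup>1 S\<close> minus the bias \<open>A\<^sup>-\<^sup>1 (A - V) \<theta>\<close>, whose \<open>A\<close>-norm is computed in an eigenbasis of \<open>V\<close>
  (\<open>regularization_bias\<close>). The events are measurable because eigenvalues are extremal values of quadratic
  forms, \<open>V \<or> \<rho> I\<close> is a metric projection, and the remaining functions are monotone.\<close>

section \<open>Orthonormal families and the spectral theorem\<close>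

definition orthonormal_family :: "('n \<Rightarrow> real^'n) \<Rightarrow> bool" where
  "orthonormal_family v \<longleftrightarrow> (\<forall>i j. v i \<bullet> v j = (if i = j then 1 else 0))"

lemma outer_sq_mult: "outer_sq v *v x = (v \<bullet> x) *\<^sub>R v"
  by (simp add: outer_sq_def vec_eq_iff matrix_vector_mult_def inner_vec_def
      sum_distrib_left mult_ac)

lemma sum_matrix_vector_mult:
  "finite I \<Longrightarrow> (\<Sum>i\<in>I. A i) *v x = (\<Sum>i\<in>I. A i *v (x::real^'n))"
  by (induction I rule: finite_induct) (simp_all add: matrix_vector_mult_add_rdistrib)

lemma matrix_vector_mult_sum:
  "finite I \<Longrightarrow> (A::real^'n^'m) *v (\<Sum>i\<in>I. x i) = (\<Sum>i\<in>I. A *v x i)"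
  by (induction I rule: finite_induct) (simp_all add: matrix_vector_right_distrib)

lemma spectral_sum_mult:
  fixes v :: "'n::finite \<Rightarrow> real^'n"
  shows "(\<Sum>i\<in>UNIV. f i *\<^sub>R outer_sq (v i)) *v (x::real^'n)
     = (\<Sum>i\<in>UNIV. (f i * (v i \<bullet> x)) *\<^sub>R v i)"
  by (simp add: sum_matrix_vector_mult scaleR_matrix_vector_assoc[symmetric] outer_sq_mult)

lemma transpose_spectral_sum:
  fixes v :: "'n::finite \<Rightarrow> real^'n"
  shows "transpose (\<Sum>i\<in>UNIV. f i *\<^sub>R outer_sq (v i)) = (\<Sum>i\<in>UNIV. f i *\<^sub>R outer_sq (v i :: real^'n))"
  by (simp add: transpose_def vec_eq_iff outer_sq_def mult_ac)

lemma symmetric_inner: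
  fixes A :: "real^'n^'n"
  assumes "transpose A = A"
  shows "(A *v x) \<bullet> y = x \<bullet> (A *v y)"
  by (metis assms dot_lmul_matrix transpose_matrix_vector)

lemma orthonormal_expansion:
  assumes "orthonormal_family (v :: 'n::finite \<Rightarrow> real^'n)"
  shows "(\<Sum>i\<in>UNIV. (v i \<bullet> x) *\<^sub>R v i) = x"
proof -
  have on: "v i \<bullet> v j = (if i = j then 1 else 0)" for i j
    using assms by (simp add: orthonormal_family_def)
  have inj: "inj v"
  proof (rule injI)
    fix i j assume "v i = v j"
    then show "i = j" using on[of i j] on[of i i] by (auto split: if_splits)
  qed
  have "pairwise orthogonal (range v)"
    by (auto simp: pairwise_def orthogonal_def on)
  moreover have "0 \<notin> range v" using on by (metis imageE inner_zero_left zero_neq_one)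
  ultimately have ind: "independent (range v)" by (rule pairwise_orthogonal_independent)
  have "card (range v) = DIM(real^'n)" using inj by (simp add: card_image)
  then have sp: "span (range v) = UNIV"
    using card_ge_dim_independent[of "range v" UNIV] ind by auto
  define y where "y = x - (\<Sum>i\<in>UNIV. (v i \<bullet> x) *\<^sub>R v i)"
  have vy: "v j \<bullet> y = 0" for j
    by (simp add: y_def inner_diff_right inner_sum_right on mult_delta_right)
  have "orthogonal y y"
  proof (rule orthogonal_to_span)
    show "y \<in> span (range v)" by (simp add: sp)
    show "orthogonal y z" if "z \<in> range v" for z
      using that vy by (auto simp: orthogonal_def inner_commute[of y])
  qed
  then have "y \<bullet> y = 0" by (simp add: orthogonal_def)
  then show ?thesis by (simp add: y_def)
qed

lemma orthonormal_sum_inner: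
  assumes "orthonormal_family (v :: 'n::finite \<Rightarrow> real^'n)"
  shows "(\<Sum>i\<in>UNIV. a i *\<^sub>R v i) \<bullet> (\<Sum>i\<in>UNIV. b i *\<^sub>R v i) = (\<Sum>i\<in>UNIV. a i * b i)"
proof -
  have on: "v i \<bullet> v j = (if i = j then 1 else 0)" for i j
    using assms by (simp add: orthonormal_family_def)
  show ?thesis by (simp add: inner_sum_left inner_sum_right on mult_delta_right)
      (simp add: mult.commute)
qed

lemma orthonormal_coefficient:
  assumes "orthonormal_family (v :: 'n::finite \<Rightarrow> real^'n)"
  shows "v j \<bullet> (\<Sum>i\<in>UNIV. a i *\<^sub>R v i) = a j"
proof -
  have on: "v i \<bullet> v j = (if i = j then 1 else 0)" for i j
    using assms by (simp add: orthonormal_family_def)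
  show ?thesis by (simp add: inner_sum_right on mult_delta_right)
qed

lemma norm_sq_orthonormal:
  assumes "orthonormal_family (v :: 'n::finite \<Rightarrow> real^'n)"
  shows "x \<bullet> x = (\<Sum>i\<in>UNIV. (v i \<bullet> x)\<^sup>2)"
  using orthonormal_sum_inner[OF assms, of "\<lambda>i. v i \<bullet> x" "\<lambda>i. v i \<bullet> x"]
  by (simp add: orthonormal_expansion[OF assms] power2_eq_square)

lemma spectral_sum_quad:
  fixes v :: "'n::finite \<Rightarrow> real^'n"
  shows "x \<bullet> ((\<Sum>i\<in>UNIV. f i *\<^sub>R outer_sq (v i)) *v x) = (\<Sum>i\<in>UNIV. f i * (v i \<bullet> x)\<^sup>2)"
  by (simp add: spectral_sum_mult inner_sum_right power2_eq_square inner_commute mult_ac)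

text \<open>First-order optimality: for small \<open>t\<close> a linear term would dominate and take both signs.\<close>
lemma nonneg_quadratic_no_linear_term:
  fixes b q :: real
  assumes "\<And>t. 0 \<le> 2 * t * b + t\<^sup>2 * q"
  shows "b = 0"
proof (rule ccontr)
  assume b: "b \<noteq> 0"
  define d where "d = \<bar>q\<bar> + 1"
  have d: "d > 0" "q < d" by (auto simp: d_def)
  define t where "t = - b / d"
  have "2 * t * b + t\<^sup>2 * q = (b\<^sup>2 / d) * (q / d - 2)"
    using d(1) by (simp add: t_def power2_eq_square field_simps)
  moreover have "q / d - 2 < 0" using d by (simp add: field_simps)
  moreover have "b\<^sup>2 / d > 0" using b d by simp
  ultimately have "2 * t * b + t\<^sup>2 * q < 0" by (metis mult_pos_neg)
  with assms[of t] show False by simp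
qed

text \<open>A maximizer \<open>x\<close> of \<open>x \<bullet> V x\<close> on the unit sphere of the subspace is an eigenvector: the form
  \<open>c (y \<bullet> y) - y \<bullet> V y\<close> is non-negative on the subspace and vanishes at \<open>x\<close>, so its gradient
  \<open>2 (c x - V x)\<close> at \<open>x\<close> is orthogonal to the subspace, to which it also belongs.\<close>
lemma symmetric_eigenvector_in_invariant_subspace:
  fixes V :: "real^'n^'n"
  assumes sym: "transpose V = V" and S: "subspace S" and nz: "\<exists>x\<in>S. x \<noteq> 0"
    and inv: "\<And>x. x \<in> S \<Longrightarrow> V *v x \<in> S"
  obtains x c where "x \<in> S" "norm x = 1" "V *v x = c *\<^sub>R x"
proof -
  have cont: "continuous_on A (\<lambda>x. x \<bullet> (V *v x))" for A
    by (intro continuous_intros linear_continuous_on linear_conv_bounded_linear[THEN iffD1]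
        matrix_vector_mul_linear)
  have comp: "compact (sphere 0 1 \<inter> S)"
    using S by (intro compact_Int_closed closed_subspace) auto
  obtain z where z: "z \<in> S" "z \<noteq> 0" using nz by blast
  have "z /\<^sub>R norm z \<in> sphere 0 1 \<inter> S"
    using z S by (auto intro: subspace_scale)
  then have ne: "sphere 0 1 \<inter> S \<noteq> {}" by blast
  obtain x where x: "x \<in> sphere 0 1 \<inter> S"
    and xmax: "\<And>y. y \<in> sphere 0 1 \<inter> S \<Longrightarrow> y \<bullet> (V *v y) \<le> x \<bullet> (V *v x)"
    using continuous_attains_sup[OF comp ne cont] by blast
  define c where "c = x \<bullet> (V *v x)"
  have quad: "y \<bullet> (V *v y) \<le> c * (y \<bullet> y)" if "y \<in> S" for y
  proof (cases "y = 0")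
    case False
    have "y /\<^sub>R norm y \<in> sphere 0 1 \<inter> S"
      using False S that by (auto intro: subspace_scale)
    from xmax[OF this] have "(y \<bullet> (V *v y)) / (norm y)\<^sup>2 \<le> c"
      by (simp add: c_def matrix_vector_mult_scaleR power2_eq_square field_simps)
    then show ?thesis using False by (simp add: field_simps dot_square_norm)
  qed auto
  define y where "y = c *\<^sub>R x - V *v x"
  have yS: "y \<in> S" unfolding y_def using x S inv by (auto intro!: subspace_diff subspace_scale)
  have xx: "x \<bullet> x = 1" using x by (simp add: dot_square_norm)
  have "0 \<le> 2 * t * (y \<bullet> y) + t\<^sup>2 * (c * (y \<bullet> y) - y \<bullet> (V *v y))" for t
  proof -
    have "x + t *\<^sub>R y \<in> S" using x yS S by (auto intro!: subspace_add subspace_scale)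
    from quad[OF this] have "0 \<le> c * ((x + t *\<^sub>R y) \<bullet> (x + t *\<^sub>R y)) - (x + t *\<^sub>R y) \<bullet> (V *v (x + t *\<^sub>R y))"
      by simp
    also have "\<dots> = (c - x \<bullet> (V *v x)) + 2 * t * ((c *\<^sub>R x - V *v x) \<bullet> y) + t\<^sup>2 * (c * (y \<bullet> y) - y \<bullet> (V *v y))"
      using symmetric_inner[OF sym, of x y]
      by (simp add: inner_add_left inner_add_right inner_diff_left matrix_vector_right_distrib
          matrix_vector_mult_scaleR xx power2_eq_square algebra_simps inner_commute)
    finally show ?thesis by (simp add: c_def y_def)
  qed
  then have "y \<bullet> y = 0" by (rule nonneg_quadratic_no_linear_term)
  then have "V *v x = c *\<^sub>R x" by (simp add: y_def)
  with x show ?thesis by (intro that) auto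
qed

text \<open>An orthonormal set of eigenvectors of maximal cardinality is a basis: its orthogonal complement is
  invariant under \<open>V\<close>, and an eigenvector in there could be added to the set.\<close>
theorem spectral_decomposition_exists:
  fixes V :: "real^'n^'n"
  assumes sym: "transpose V = V"
  obtains c v where "spectral_decomposition V c v"
proof -
  define P where "P B \<longleftrightarrow> finite B \<and> pairwise orthogonal B \<and>
      (\<forall>b\<in>B. norm b = 1 \<and> (\<exists>c. V *v b = c *\<^sub>R b))" for B :: "(real^'n) set"
  have ind: "independent B" if "P B" for B
    using that unfolding P_def by (intro pairwise_orthogonal_independent) auto
  have bound: "card B \<le> DIM(real^'n)" if "P B" for B
    using independent_bound[OF ind[OF that]] by simp
  have "P {}" by (simp add: P_def)
  moreover have "\<forall>B. P B \<longrightarrow> card B < DIM(real^'n) + 1"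
    by (intro allI impI) (drule bound, simp)
  ultimately have "\<exists>B. P B \<and> (\<forall>B'. P B' \<longrightarrow> card B' \<le> card B)"
    by (rule ex_has_greatest_nat[of P "{}" card])
  then obtain B where BB: "P B \<and> (\<forall>B'. P B' \<longrightarrow> card B' \<le> card B)" ..
  then have B: "P B" and Bmax: "\<And>B'. P B' \<Longrightarrow> card B' \<le> card B" by simp_all
  have eigB: "\<exists>c. V *v b = c *\<^sub>R b" if "b \<in> B" for b using B that unfolding P_def by simp
  define S where "S = {y. \<forall>b\<in>B. b \<bullet> y = 0}"
  have sub: "subspace S" by (auto simp: S_def subspace_def inner_add_right)
  have inv: "V *v x \<in> S" if "x \<in> S" for x
  proof -
    have "b \<bullet> (V *v x) = 0" if bB: "b \<in> B" for b
    proof -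
      obtain c where "V *v b = c *\<^sub>R b" using eigB[OF bB] ..
      then show ?thesis using symmetric_inner[OF sym, of b x] \<open>x \<in> S\<close> bB by (simp add: S_def)
    qed
    then show ?thesis by (simp add: S_def)
  qed
  have S0: "x = 0" if "x \<in> S" for x
  proof (rule ccontr)
    assume "x \<noteq> 0"
    with that obtain z c where z: "z \<in> S" "norm z = 1" "V *v z = c *\<^sub>R z"
      using symmetric_eigenvector_in_invariant_subspace[OF sym sub _ inv] by blast
    have "z \<notin> B" using z by (auto simp: S_def)
    moreover have "P (insert z B)"
      using B z by (auto simp: P_def pairwise_insert orthogonal_def S_def inner_commute)
    ultimately show False using Bmax[of "insert z B"] B by (simp add: P_def)
  qed
  have spanB: "span B = UNIV"
  proof (rule ccontr)
    assume "span B \<noteq> UNIV"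
    then have "span B \<subset> span UNIV" by auto
    then obtain x where "x \<noteq> 0" "\<And>y. y \<in> span B \<Longrightarrow> orthogonal x y"
      using orthogonal_to_subspace_exists_gen[of B UNIV] by auto
    then have "x \<in> S" by (auto simp: S_def orthogonal_def span_base inner_commute)
    with S0 \<open>x \<noteq> 0\<close> show False by blast
  qed
  have "card B = DIM(real^'n)"
    using dim_eq_card_independent[OF ind[OF B]] dim_span[of B] by (simp add: spanB)
  then have "card (UNIV::'n set) = card B" by simp
  then obtain v where v: "bij_betw v (UNIV::'n set) B"
    using finite_same_card_bij[of "UNIV::'n set" B] B by (auto simp: P_def)
  have vB: "v i \<in> B" for i using v by (auto simp: bij_betw_def)
  have "\<forall>i. \<exists>c. V *v v i = c *\<^sub>R v i" using eigB[OF vB] by simp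
  then obtain c where c: "\<And>i. V *v v i = c i *\<^sub>R v i" by metis
  have on: "orthonormal_family v"
  proof -
    have "v i \<bullet> v j = 0" if "i \<noteq> j" for i j
    proof -
      have "v i \<noteq> v j" using v that by (auto simp: bij_betw_def inj_def)
      then show ?thesis using B vB by (auto simp: P_def pairwise_def orthogonal_def)
    qed
    moreover have "v i \<bullet> v i = 1" for i using B vB by (simp add: P_def dot_square_norm)
    ultimately show ?thesis by (auto simp: orthonormal_family_def)
  qed
  have "V *v x = (\<Sum>i\<in>UNIV. c i *\<^sub>R outer_sq (v i)) *v x" for x
  proof -
    have "V *v x = V *v (\<Sum>i\<in>UNIV. (v i \<bullet> x) *\<^sub>R v i)"
      by (simp add: orthonormal_expansion[OF on])
    also have "\<dots> = (\<Sum>i\<in>UNIV. (v i \<bullet> x) *\<^sub>R (c i *\<^sub>R v i))"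
      by (simp add: matrix_vector_mult_sum matrix_vector_mult_scaleR c)
    finally show ?thesis by (simp add: spectral_sum_mult mult.commute)
  qed
  then have "V = (\<Sum>i\<in>UNIV. c i *\<^sub>R outer_sq (v i))" by (simp add: matrix_eq)
  with on show ?thesis by (intro that[of c v]) (simp add: spectral_decomposition_def orthonormal_family_def)
qed

lemma spectral_decomposition_iff:
  "spectral_decomposition V c v \<longleftrightarrow>
     orthonormal_family v \<and> V = (\<Sum>i\<in>UNIV. c i *\<^sub>R outer_sq (v i))"
  by (simp add: spectral_decomposition_def orthonormal_family_def)

lemma spectral_decomposition_eigenvector:
  assumes "spectral_decomposition V c v" "V *v x = k *\<^sub>R x"
  shows "c i * (v i \<bullet> x) = k * (v i \<bullet> x)"
proof -
  have on: "orthonormal_family v" and V: "V = (\<Sum>i\<in>UNIV. c i *\<^sub>R outer_sq (v i))"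
    using assms by (auto simp: spectral_decomposition_iff)
  have "v i \<bullet> (V *v x) = c i * (v i \<bullet> x)"
    by (simp add: V spectral_sum_mult orthonormal_coefficient[OF on])
  then show ?thesis using assms(2) by auto
qed

lemma spectral_decomposition_mult:
  assumes "spectral_decomposition V c v"
  shows "V *v v i = c i *\<^sub>R v i"
proof -
  have on: "v i \<bullet> v j = (if i = j then 1 else 0)" for i j
    using assms by (simp add: spectral_decomposition_def)
  have V: "V = (\<Sum>i\<in>UNIV. c i *\<^sub>R outer_sq (v i))"
    using assms by (simp add: spectral_decomposition_def)
  have "(\<Sum>j\<in>UNIV. (c j * (v j \<bullet> v i)) *\<^sub>R v j) = (\<Sum>j\<in>UNIV. if j = i then c j *\<^sub>R v j else 0)"
    by (rule sum.cong) (auto simp: on)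
  then show ?thesis unfolding V spectral_sum_mult by simp
qed

text \<open>The functional calculus does not depend on the decomposition: the matrix built from a second
  decomposition maps an eigenvector of \<open>V\<close> for the eigenvalue \<open>c\<close> to its multiple by \<open>f c\<close>, so the
  two matrices agree on the basis given by the first decomposition.\<close>
lemma spectral_map_eq:
  assumes "spectral_decomposition V c v"
  shows "spectral_map f V = (\<Sum>i\<in>UNIV. f (c i) *\<^sub>R outer_sq (v i))"
  unfolding spectral_map_def
proof (rule the_equality)
  show "\<exists>c' v'. spectral_decomposition V c' v' \<and>
      (\<Sum>i\<in>UNIV. f (c i) *\<^sub>R outer_sq (v i)) = (\<Sum>i\<in>UNIV. f (c' i) *\<^sub>R outer_sq (v' i))"
    using assms by blast
  fix W assume "\<exists>c' v'. spectral_decomposition V c' v' \<and> W = (\<Sum>i\<in>UNIV. f (c' i) *\<^sub>R outer_sq (v' i))"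
  then obtain c' v' where d: "spectral_decomposition V c' v'"
    and W: "W = (\<Sum>i\<in>UNIV. f (c' i) *\<^sub>R outer_sq (v' i))" by blast
  have on: "orthonormal_family v" using assms by (simp add: spectral_decomposition_iff)
  have on': "orthonormal_family v'" using d by (simp add: spectral_decomposition_iff)
  have Wv: "W *v v i = f (c i) *\<^sub>R v i" for i
  proof -
    have eq: "f (c' j) * (v' j \<bullet> v i) = f (c i) * (v' j \<bullet> v i)" for j
      using spectral_decomposition_eigenvector[OF d spectral_decomposition_mult[OF assms, of i], of j] by auto
    have "W *v v i = (\<Sum>j\<in>UNIV. (f (c i) * (v' j \<bullet> v i)) *\<^sub>R v' j)"
      unfolding W spectral_sum_mult by (simp add: eq)
    also have "\<dots> = f (c i) *\<^sub>R (\<Sum>j\<in>UNIV. (v' j \<bullet> v i) *\<^sub>R v' j)"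
      by (simp add: scaleR_sum_right)
    finally show ?thesis by (simp add: orthonormal_expansion[OF on'])
  qed
  have "W *v x = (\<Sum>i\<in>UNIV. f (c i) *\<^sub>R outer_sq (v i)) *v x" for x
  proof -
    have "W *v x = W *v (\<Sum>i\<in>UNIV. (v i \<bullet> x) *\<^sub>R v i)"
      by (simp add: orthonormal_expansion[OF on])
    also have "\<dots> = (\<Sum>i\<in>UNIV. f (c i) *\<^sub>R outer_sq (v i)) *v x"
      unfolding spectral_sum_mult
      by (simp add: matrix_vector_mult_sum matrix_vector_mult_scaleR Wv mult.commute)
    finally show ?thesis .
  qed
  then show "W = (\<Sum>i\<in>UNIV. f (c i) *\<^sub>R outer_sq (v i))" by (simp add: matrix_eq)
qed

lemma spectral_decomposition_spectral_map:
  "spectral_decomposition V c v \<Longrightarrow> spectral_decomposition (spectral_map f V) (\<lambda>i. f (c i)) v"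
  by (simp add: spectral_map_eq) (simp add: spectral_decomposition_def)

lemma spectral_decomposition_symmetric:
  "spectral_decomposition V c v \<Longrightarrow> transpose V = V"
  by (simp add: spectral_decomposition_iff transpose_spectral_sum)

lemma spectral_decomposition_quad:
  "spectral_decomposition V c v \<Longrightarrow> x \<bullet> (V *v x) = (\<Sum>i\<in>UNIV. c i * (v i \<bullet> x)\<^sup>2)"
  by (simp add: spectral_decomposition_iff spectral_sum_quad)

section \<open>Extreme eigenvalues\<close>

lemma eigenvalues_eq_range:
  assumes "spectral_decomposition V c v"
  shows "eigenvalues V = range c"
proof
  have on: "orthonormal_family v" using assms by (simp add: spectral_decomposition_iff)
  show "eigenvalues V \<subseteq> range c"
  proof
    fix k assume "k \<in> eigenvalues V"
    then obtain x where x: "x \<noteq> 0" "V *v x = k *\<^sub>R x" by (auto simp: eigenvalues_def)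
    have "\<exists>i. v i \<bullet> x \<noteq> 0"
    proof (rule ccontr)
      assume "\<nexists>i. v i \<bullet> x \<noteq> 0"
      then have "x \<bullet> x = 0" unfolding norm_sq_orthonormal[OF on, of x] by simp
      then show False using x(1) by simp
    qed
    then obtain i where "v i \<bullet> x \<noteq> 0" ..
    with spectral_decomposition_eigenvector[OF assms x(2), of i] show "k \<in> range c" by auto
  qed
  show "range c \<subseteq> eigenvalues V"
  proof
    fix k assume "k \<in> range c"
    then obtain i where k: "k = c i" by blast
    have "v i \<noteq> 0" using on by (metis inner_zero_left orthonormal_family_def zero_neq_one)
    then show "k \<in> eigenvalues V"
      using spectral_decomposition_mult[OF assms, of i] k by (auto simp: eigenvalues_def)
  qed
qed

text \<open>The Rayleigh quotient description of the extreme eigenvalues. Through it, the comparisons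
  \<open>A \<ge> \<rho> I\<close> and \<open>A \<ge> V\<close> are used, and superlevel sets of the
  smallest and sublevel sets of the largest eigenvalue are closed relative to the symmetric matrices.\<close>
lemma le_eig_min_iff:
  fixes A :: "real^'n^'n"
  assumes "transpose A = A"
  shows "k \<le> eig_min A \<longleftrightarrow> (\<forall>x. k * (x \<bullet> x) \<le> x \<bullet> (A *v x))"
proof -
  obtain c v where d: "spectral_decomposition A c v" using spectral_decomposition_exists[OF assms] .
  have on: "orthonormal_family v" using d by (simp add: spectral_decomposition_iff)
  have "k \<le> eig_min A \<longleftrightarrow> (\<forall>i. k \<le> c i)"
    by (simp add: eig_min_def eigenvalues_eq_range[OF d])
  also have "\<dots> \<longleftrightarrow> (\<forall>x. k * (x \<bullet> x) \<le> x \<bullet> (A *v x))"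
  proof safe
    fix x assume "\<forall>i. k \<le> c i"
    then show "k * (x \<bullet> x) \<le> x \<bullet> (A *v x)"
      by (auto simp: norm_sq_orthonormal[OF on] spectral_decomposition_quad[OF d] sum_distrib_left
          intro!: sum_mono mult_right_mono)
  next
    fix i assume "\<forall>x. k * (x \<bullet> x) \<le> x \<bullet> (A *v x)"
    then have "k * (v i \<bullet> v i) \<le> v i \<bullet> (A *v v i)" by blast
    then show "k \<le> c i" using on by (simp add: spectral_decomposition_mult[OF d] orthonormal_family_def)
  qed
  finally show ?thesis .
qed

lemma eig_max_le_iff:
  fixes A :: "real^'n^'n"
  assumes "transpose A = A"
  shows "eig_max A \<le> k \<longleftrightarrow> (\<forall>x. x \<bullet> (A *v x) \<le> k * (x \<bullet> x))"
proof -
  obtain c v where d: "spectral_decomposition A c v" using spectral_decomposition_exists[OF assms] .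
  have on: "orthonormal_family v" using d by (simp add: spectral_decomposition_iff)
  have "eig_max A \<le> k \<longleftrightarrow> (\<forall>i. c i \<le> k)"
    by (simp add: eig_max_def eigenvalues_eq_range[OF d])
  also have "\<dots> \<longleftrightarrow> (\<forall>x. x \<bullet> (A *v x) \<le> k * (x \<bullet> x))"
  proof safe
    fix x assume "\<forall>i. c i \<le> k"
    then show "x \<bullet> (A *v x) \<le> k * (x \<bullet> x)"
      by (auto simp: norm_sq_orthonormal[OF on] spectral_decomposition_quad[OF d] sum_distrib_left
          intro!: sum_mono mult_right_mono)
  next
    fix i assume "\<forall>x. x \<bullet> (A *v x) \<le> k * (x \<bullet> x)"
    then have "v i \<bullet> (A *v v i) \<le> k * (v i \<bullet> v i)" by blast
    then show "c i \<le> k" using on by (simp add: spectral_decomposition_mult[OF d] orthonormal_family_def)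
  qed
  finally show ?thesis .
qed

lemma eig_min_quad:
  "transpose A = A \<Longrightarrow> eig_min A * (x \<bullet> x) \<le> x \<bullet> (A *v (x::real^'n))"
  using le_eig_min_iff[of A "eig_min A"] by blast

lemma eig_max_quad:
  "transpose A = A \<Longrightarrow> x \<bullet> (A *v (x::real^'n)) \<le> eig_max A * (x \<bullet> x)"
  using eig_max_le_iff[of A "eig_max A"] by blast

lemma eig_min_le_eig_max:
  fixes A :: "real^'n^'n"
  assumes "transpose A = A"
  shows "eig_min A \<le> eig_max A"
proof -
  obtain i :: 'n where True by simp
  have "eig_min A * (axis i 1 \<bullet> (axis i 1 :: real^'n)) \<le> eig_max A * (axis i 1 \<bullet> (axis i 1 :: real^'n))"
    using eig_min_quad[OF assms] eig_max_quad[OF assms] by (rule order_trans)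
  then show ?thesis by (simp add: inner_axis_axis)
qed

lemma psd_iff_eig_min: "psd A \<longleftrightarrow> transpose A = A \<and> 0 \<le> eig_min A"
  using le_eig_min_iff[of A 0] by (auto simp: psd_def)

lemma invertible_if_eig_min_pos:
  fixes A :: "real^'n^'n"
  assumes "transpose A = A" "0 < eig_min A"
  shows "invertible A"
proof -
  have "x = 0" if "A *v x = 0" for x
  proof -
    have "eig_min A * (x \<bullet> x) \<le> 0" using eig_min_quad[OF assms(1), of x] that by simp
    then have "x \<bullet> x \<le> 0" using assms(2) by (simp add: mult_le_0_iff)
    then show ?thesis using inner_gt_zero_iff[of x] by linarith
  qed
  then show ?thesis
    by (simp add: invertible_left_inverse matrix_left_invertible_ker)
qed

lemma matrix_inv_mult_cancel:
  fixes A :: "real^'n^'n"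
  assumes "invertible A"
  shows "A *v (matrix_inv A *v x) = x" "matrix_inv A *v (A *v x) = x"
proof -
  have "A ** matrix_inv A = mat 1 \<and> matrix_inv A ** A = mat 1"
    using assms unfolding invertible_def matrix_inv_def by (rule someI_ex)
  then show "A *v (matrix_inv A *v x) = x" "matrix_inv A *v (A *v x) = x"
    by (simp_all add: matrix_vector_mul_assoc)
qed

text \<open>Norms weighted by the square root of \<open>A\<close> only ever enter through the quadratic form of \<open>A\<close>, so the matrix square
  root can be eliminated.\<close>
lemma norm_mat_sqrt:
  fixes A :: "real^'n^'n"
  assumes "psd A"
  shows "norm (mat_sqrt A *v x) = sqrt (x \<bullet> (A *v x))"
proof -
  have sym: "transpose A = A" using assms by (simp add: psd_def)
  obtain c v where d: "spectral_decomposition A c v" using spectral_decomposition_exists[OF sym] .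
  have on: "orthonormal_family v" using d by (simp add: spectral_decomposition_iff)
  have c: "0 \<le> c i" for i
  proof -
    have "0 \<le> v i \<bullet> (A *v v i)" using assms by (simp add: psd_def)
    then show ?thesis using on by (simp add: spectral_decomposition_mult[OF d] orthonormal_family_def)
  qed
  have "(norm (mat_sqrt A *v x))\<^sup>2 = x \<bullet> (A *v x)"
    unfolding power2_norm_eq_inner mat_sqrt_def spectral_map_eq[OF d] spectral_sum_mult
      orthonormal_sum_inner[OF on] spectral_decomposition_quad[OF d]
    by (simp add: power2_eq_square[symmetric] power_mult_distrib c)
  then show ?thesis by (metis norm_ge_zero real_sqrt_unique)
qed

section \<open>Truncating the spectrum from below\<close>

lemma spectral_decomposition_mat_max:
  "spectral_decomposition V c v \<Longrightarrow> spectral_decomposition (mat_max V \<rho>) (\<lambda>i. max (c i) \<rho>) v"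
  unfolding mat_max_def by (rule spectral_decomposition_spectral_map)

lemma
  fixes V :: "real^'n^'n"
  assumes "transpose V = V"
  shows transpose_mat_max: "transpose (mat_max V \<rho>) = mat_max V \<rho>"
    and le_eig_min_mat_max: "\<rho> \<le> eig_min (mat_max V \<rho>)"
    and quad_le_quad_mat_max: "x \<bullet> (V *v x) \<le> x \<bullet> (mat_max V \<rho> *v x)"
proof -
  obtain c v where d: "spectral_decomposition V c v" using spectral_decomposition_exists[OF assms] .
  note d' = spectral_decomposition_mat_max[OF d]
  show "transpose (mat_max V \<rho>) = mat_max V \<rho>" using spectral_decomposition_symmetric[OF d'] .
  show "\<rho> \<le> eig_min (mat_max V \<rho>)" by (simp add: eig_min_def eigenvalues_eq_range[OF d'])
  show "x \<bullet> (V *v x) \<le> x \<bullet> (mat_max V \<rho> *v x)"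
    unfolding spectral_decomposition_quad[OF d] spectral_decomposition_quad[OF d']
    by (intro sum_mono mult_right_mono) auto
qed

lemma mat_max_id:
  fixes V :: "real^'n^'n"
  assumes "transpose V = V" "\<rho> \<le> eig_min V"
  shows "mat_max V \<rho> = V"
proof -
  obtain c v where d: "spectral_decomposition V c v" using spectral_decomposition_exists[OF assms(1)] .
  have "\<rho> \<le> c i" for i using assms(2) by (simp add: eig_min_def eigenvalues_eq_range[OF d])
  then have "mat_max V \<rho> = (\<Sum>i\<in>UNIV. c i *\<^sub>R outer_sq (v i))"
    unfolding mat_max_def spectral_map_eq[OF d] by (simp add: max_absorb1)
  then show ?thesis using d by (simp add: spectral_decomposition_def)
qed

lemma inner_outer_sq: "outer_sq v \<bullet> W = v \<bullet> (W *v (v::real^'n))"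
  by (simp add: outer_sq_def inner_vec_def matrix_vector_mult_def sum_distrib_left mult_ac)

lemma continuous_quad: "continuous_on UNIV (\<lambda>W::real^'n^'n. x \<bullet> (W *v x))"
  unfolding inner_outer_sq[symmetric] by (intro continuous_intros)

definition symmetric_above :: "real \<Rightarrow> (real^'n^'n) set" where
  "symmetric_above \<rho> = {W. transpose W = W \<and> (\<forall>x. \<rho> * (x \<bullet> x) \<le> x \<bullet> (W *v x))}"

text \<open>\<open>V \<or> \<rho> I\<close> is the projection, in the Frobenius norm, of \<open>V\<close> onto the closed convex set of symmetric
  matrices above \<open>\<rho> I\<close>. Indeed \<open>V - (V \<or> \<rho> I)\<close> is a combination, with non-positive weights, of the
  \<open>v v\<^sup>T\<close> for the eigenvectors \<open>v\<close> of eigenvalue below \<open>\<rho>\<close>, and for each of these \<open>v \<bullet> W v \<ge> \<rho>\<close> for every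
  \<open>W\<close> in the set, with equality for \<open>V \<or> \<rho> I\<close>. Projections onto convex sets are continuous, so \<open>V \<or> \<rho> I\<close>
  depends measurably on \<open>V\<close> although the eigenvectors cannot be chosen continuously.\<close>
lemma mat_max_eq_closest_point:
  fixes V :: "real^'n^'n"
  assumes "transpose V = V"
  shows "mat_max V \<rho> = closest_point (symmetric_above \<rho>) V"
    and "closed (symmetric_above \<rho> :: (real^'n^'n) set)" "convex (symmetric_above \<rho> :: (real^'n^'n) set)"
      "symmetric_above \<rho> \<noteq> ({} :: (real^'n^'n) set)"
proof -
  let ?C = "symmetric_above \<rho> :: (real^'n^'n) set"
  have "?C = {W. \<forall>i j. W $ i $ j = W $ j $ i} \<inter> (\<Inter>x. {W. \<rho> * (x \<bullet> x) \<le> x \<bullet> (W *v x)})"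
    by (auto simp: symmetric_above_def transpose_def vec_eq_iff)
  moreover have "closed {W::real^'n^'n. \<forall>i j. W $ i $ j = W $ j $ i}"
    by (intro closed_Collect_all closed_Collect_eq continuous_intros)
  moreover have "closed {W::real^'n^'n. \<rho> * (x \<bullet> x) \<le> x \<bullet> (W *v x)}" for x
    by (intro closed_Collect_le continuous_intros continuous_quad)
  ultimately show cl: "closed ?C" by (simp add: closed_Int closed_INT)
  show cv: "convex ?C"
  proof (rule convexI)
    fix W W' :: "real^'n^'n" and a b :: real
    assume h: "W \<in> ?C" "W' \<in> ?C" "0 \<le> a" "0 \<le> b" "a + b = 1"
    have "transpose (a *\<^sub>R W + b *\<^sub>R W') = a *\<^sub>R transpose W + b *\<^sub>R transpose W'"
      by (simp add: transpose_def vec_eq_iff)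
    moreover have "\<rho> * (x \<bullet> x) \<le> x \<bullet> ((a *\<^sub>R W + b *\<^sub>R W') *v x)" for x
    proof -
      have "\<rho> * (x \<bullet> x) = a * (\<rho> * (x \<bullet> x)) + b * (\<rho> * (x \<bullet> x))"
        using h(5) by (simp flip: distrib_right)
      also have "\<dots> \<le> a * (x \<bullet> (W *v x)) + b * (x \<bullet> (W' *v x))"
        using h by (intro add_mono mult_left_mono) (auto simp: symmetric_above_def)
      finally show ?thesis
        by (simp add: matrix_vector_mult_add_rdistrib inner_add_right scaleR_matrix_vector_assoc[symmetric])
    qed
    ultimately show "a *\<^sub>R W + b *\<^sub>R W' \<in> ?C" using h by (simp add: symmetric_above_def)
  qed
  obtain c v where d: "spectral_decomposition V c v" using spectral_decomposition_exists[OF assms] .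
  note d' = spectral_decomposition_mat_max[OF d, of \<rho>]
  have V: "V = (\<Sum>i\<in>UNIV. c i *\<^sub>R outer_sq (v i))" using d by (simp add: spectral_decomposition_iff)
  have M: "mat_max V \<rho> = (\<Sum>i\<in>UNIV. max (c i) \<rho> *\<^sub>R outer_sq (v i))" using d' by (simp add: spectral_decomposition_iff)
  have on: "orthonormal_family v" using d by (simp add: spectral_decomposition_iff)
  have M_in: "mat_max V \<rho> \<in> ?C"
    using transpose_mat_max[OF assms] le_eig_min_mat_max[OF assms]
      le_eig_min_iff[OF transpose_mat_max[OF assms]]
    by (auto simp: symmetric_above_def)
  then show "?C \<noteq> {}" by blast
  have var: "(V - mat_max V \<rho>) \<bullet> (W - mat_max V \<rho>) \<le> 0" if W: "W \<in> ?C" for W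
  proof -
    have "V - mat_max V \<rho> = (\<Sum>i\<in>UNIV. (c i - max (c i) \<rho>) *\<^sub>R outer_sq (v i))"
      unfolding M by (subst V) (simp add: sum_subtractf scaleR_diff_left)
    then have "(V - mat_max V \<rho>) \<bullet> (W - mat_max V \<rho>)
        = (\<Sum>i\<in>UNIV. (c i - max (c i) \<rho>) *\<^sub>R outer_sq (v i)) \<bullet> (W - mat_max V \<rho>)" by simp
    also have "\<dots> = (\<Sum>i\<in>UNIV. (c i - max (c i) \<rho>) * (v i \<bullet> (W *v v i) - max (c i) \<rho>))"
      using on by (simp add: inner_sum_left inner_diff_right inner_outer_sq
          spectral_decomposition_mult[OF d'] orthonormal_family_def
          right_diff_distrib sum_subtractf)
    also have "\<dots> \<le> 0"
    proof (rule sum_nonpos)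
      fix i
      have "\<rho> * (v i \<bullet> v i) \<le> v i \<bullet> (W *v v i)" using W by (simp add: symmetric_above_def)
      then have "\<rho> \<le> v i \<bullet> (W *v v i)" using on by (simp add: orthonormal_family_def)
      then show "(c i - max (c i) \<rho>) * (v i \<bullet> (W *v v i) - max (c i) \<rho>) \<le> 0"
        by (auto simp: max_def mult_le_0_iff)
    qed
    finally show ?thesis .
  qed
  show "mat_max V \<rho> = closest_point ?C V"
  proof (rule closest_point_unique[OF cv cl M_in], rule)
    fix W assume W: "W \<in> ?C"
    have "(dist V (mat_max V \<rho>))\<^sup>2 \<le> (dist V W)\<^sup>2"
    proof -
      have "(dist V W)\<^sup>2 = (V - mat_max V \<rho>) \<bullet> (V - mat_max V \<rho>)
         - 2 * ((V - mat_max V \<rho>) \<bullet> (W - mat_max V \<rho>)) + (W - mat_max V \<rho>) \<bullet> (W - mat_max V \<rho>)"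
        by (simp add: dist_norm power2_norm_eq_inner inner_diff_left inner_diff_right inner_commute)
      then show ?thesis using var[OF W] inner_ge_zero[of "W - mat_max V \<rho>"]
        unfolding dist_norm power2_norm_eq_inner by linarith
    qed
    then show "dist V (mat_max V \<rho>) \<le> dist V W" by (rule power2_le_imp_le) simp
  qed
qed

section \<open>Convex conjugates of steep CGF-like functions\<close>

locale steep_super_gaussian =
  fixes lmax :: ereal and \<psi> :: "real \<Rightarrow> real"
  assumes cgf: "cgf_like lmax \<psi>" and steep: "steep lmax \<psi>" and super: "super_gaussian lmax \<psi>"
begin

abbreviation "D \<equiv> cgf_dom lmax"
abbreviation "psi_star \<equiv> convex_conj lmax \<psi>"
abbreviation "psi_star_inv \<equiv> convex_conj_inv lmax \<psi>"

lemma zero_in_D: "0 \<in> D"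
  using cgf by (simp add: cgf_like_def cgf_dom_def zero_ereal_def[symmetric])

lemma D_nonneg: "l \<in> D \<Longrightarrow> 0 \<le> l"
  by (simp add: cgf_dom_def)

lemma D_down: "l \<in> D \<Longrightarrow> 0 \<le> x \<Longrightarrow> x \<le> l \<Longrightarrow> x \<in> D"
  unfolding cgf_dom_def by (auto intro: le_less_trans[of "ereal x" "ereal l"])

lemma psi_nonneg: "l \<in> D \<Longrightarrow> 0 \<le> \<psi> l" and psi_0: "\<psi> 0 = 0"
  using cgf by (auto simp: cgf_like_def)

text \<open>The derivative relative to the domain; \<^const>\<open>deriv\<close> would be the two-sided derivative, which at
  \<open>0\<close> depends on the values of \<open>\<psi>\<close> at negative arguments.\<close>
definition dpsi :: "real \<Rightarrow> real" where
  "dpsi = (SOME \<psi>'. (\<forall>l\<in>D. (\<psi> has_real_derivative \<psi>' l) (at l within D)) \<and>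
       continuous_on D \<psi>' \<and> \<psi>' 0 = 0)"

lemma dpsi: "l \<in> D \<Longrightarrow> (\<psi> has_real_derivative dpsi l) (at l within D)"
    "continuous_on D dpsi" "dpsi 0 = 0"
proof -
  have "\<exists>\<psi>'. (\<forall>l\<in>D. (\<psi> has_real_derivative \<psi>' l) (at l within D)) \<and>
       continuous_on D \<psi>' \<and> \<psi>' 0 = 0"
  proof -
    obtain \<psi>' \<psi>'' where "\<forall>l\<in>D. (\<psi> has_real_derivative \<psi>' l) (at l within D)"
      "\<forall>l\<in>D. (\<psi>' has_real_derivative \<psi>'' l) (at l within D)" "\<psi>' 0 = 0"
      using cgf unfolding cgf_like_def by blast
    then show ?thesis by (metis DERIV_continuous_on)
  qed
  from someI_ex[OF this, folded dpsi_def]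
  show "l \<in> D \<Longrightarrow> (\<psi> has_real_derivative dpsi l) (at l within D)"
    "continuous_on D dpsi" "dpsi 0 = 0" by auto
qed

lemma D_interior:
  assumes "l \<in> D" "0 < l"
  shows "l \<in> interior D"
proof -
  obtain b where b: "ereal l < ereal b" "ereal b < lmax"
    using assms(1) ereal_dense2[of "ereal l" lmax] by (auto simp: cgf_dom_def)
  have "b \<in> D" using b assms by (auto simp: cgf_dom_def)
  then have "{0<..<b} \<subseteq> D" by (auto intro: D_down)
  then show ?thesis using b assms by (intro interiorI[of "{0<..<b}"]) auto
qed

lemma psi_above_tangent:
  assumes "l \<in> D" "x \<in> D"
  shows "\<psi> l + dpsi l * (x - l) \<le> \<psi> x"
proof (cases "l = 0")
  case True
  then show ?thesis using psi_nonneg[OF assms(2)] by (simp add: dpsi psi_0)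
next
  case False
  then have l: "0 < l" using D_nonneg[OF assms(1)] by simp
  have sc: "strictly_convex_on D \<psi>" using cgf by (simp add: cgf_like_def)
  then have cD: "convex D" by (simp add: strictly_convex_on_def)
  have "convex_on D \<psi>"
  proof (rule convex_onI)
    fix t x y :: real assume t: "0 < t" "t < 1" and xy: "x \<in> D" "y \<in> D"
    show "\<psi> ((1 - t) *\<^sub>R x + t *\<^sub>R y) \<le> (1 - t) * \<psi> x + t * \<psi> y"
    proof (cases "x = y")
      case True then show ?thesis by (simp add: algebra_simps)
    next
      case False
      then have "\<psi> ((1 - t) * x + (1 - (1 - t)) * y) < (1 - t) * \<psi> x + (1 - (1 - t)) * \<psi> y"
        using t xy sc[unfolded strictly_convex_on_def, THEN conjunct2, rule_format, of x y "1 - t"]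
        by simp
      then show ?thesis by simp
    qed
  qed (rule cD)
  from convex_on_imp_above_tangent[OF this convex_connected[OF cD] D_interior[OF assms(1) l] assms(2) dpsi(1)[OF assms(1)]]
  show ?thesis by simp
qed

lemma dpsi_nonneg:
  assumes "l \<in> D"
  shows "0 \<le> dpsi l"
proof (cases "l = 0")
  case False
  then have l: "0 < l" using D_nonneg[OF assms] by simp
  have "\<psi> l \<le> dpsi l * l" using psi_above_tangent[OF assms zero_in_D] by (simp add: psi_0)
  then have "0 \<le> dpsi l * l" using psi_nonneg[OF assms] by linarith
  then show ?thesis using l by (simp add: zero_le_mult_iff)
qed (simp add: dpsi)

lemma dpsi_unbounded:
  assumes l0: "l0 \<in> D"
  obtains l where "l \<in> D" "l0 \<le> l" "K \<le> dpsi l"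
proof -
  have "\<forall>\<^sub>F x in at_left lmax. K \<le> deriv \<psi> (real_of_ereal x)"
    using steep unfolding steep_def filterlim_at_top by blast
  moreover have "0 < lmax" using cgf by (simp add: cgf_like_def)
  ultimately obtain b where b: "b < lmax"
    "\<And>y. b < y \<Longrightarrow> y < lmax \<Longrightarrow> K \<le> deriv \<psi> (real_of_ereal y)"
    using eventually_at_left[of 0 lmax] by auto
  have "max b (ereal l0) < lmax" using b l0 by (simp add: cgf_dom_def)
  then obtain l where l: "max b (ereal l0) < ereal l" "ereal l < lmax"
    using ereal_dense2 by blast
  have l0l: "0 \<le> l0" "l0 < l" using l D_nonneg[OF l0] by auto
  then have lD: "l \<in> D" using l by (simp add: cgf_dom_def)
  have "K \<le> deriv \<psi> l" using b(2)[of "ereal l"] l by simp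
  moreover have "deriv \<psi> l = dpsi l"
    using dpsi(1)[OF lD] at_within_interior[OF D_interior[OF lD]] l0l by (simp add: DERIV_imp_deriv)
  ultimately show ?thesis using that lD l0l by simp
qed

text \<open>The supremum in the conjugate is attained where the slope of \<open>\<psi>\<close> is \<open>u\<close>, since \<open>\<psi>\<close> lies above its
  tangents. By steepness every \<open>u \<ge> 0\<close> is such a slope.\<close>
lemma psi_star_at_dpsi:
  assumes "l \<in> D"
  shows "psi_star (dpsi l) = dpsi l * l - \<psi> l"
  unfolding convex_conj_def
proof (rule cSup_eq_maximum)
  show "dpsi l * l - \<psi> l \<in> (\<lambda>x. dpsi l * x - \<psi> x) ` D" using assms by auto
  fix z assume "z \<in> (\<lambda>x. dpsi l * x - \<psi> x) ` D"
  then show "z \<le> dpsi l * l - \<psi> l"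
    using psi_above_tangent[OF assms] by (force simp: algebra_simps)
qed

lemma dpsi_surj:
  assumes "0 \<le> u"
  obtains l where "l \<in> D" "dpsi l = u"
proof -
  obtain b where b: "b \<in> D" "0 \<le> b" "u \<le> dpsi b" using dpsi_unbounded[OF zero_in_D, of u] .
  have "{0..b} \<subseteq> D" using D_down[OF b(1)] by auto
  then have "continuous_on {0..b} dpsi" using dpsi(2) continuous_on_subset by blast
  then obtain l where "0 \<le> l" "l \<le> b" "dpsi l = u"
    using IVT'[of dpsi 0 u b] assms b by (auto simp: dpsi)
  then show ?thesis using that D_down[OF b(1)] by blast
qed

lemma psi_star_ge:
  assumes "0 \<le> u" "x \<in> D"
  shows "u * x - \<psi> x \<le> psi_star u"
proof -
  obtain l where l: "l \<in> D" "dpsi l = u" using dpsi_surj[OF assms(1)] .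
  then show ?thesis
    using psi_above_tangent[OF l(1) assms(2)] psi_star_at_dpsi[OF l(1)] by (simp add: algebra_simps)
qed

lemma psi_star_0: "psi_star 0 = 0"
  using psi_star_at_dpsi[OF zero_in_D] by (simp add: dpsi psi_0)

lemma psi_star_strict_mono:
  assumes "0 \<le> u" "u < u'"
  shows "psi_star u < psi_star u'"
proof -
  obtain l where l: "l \<in> D" "dpsi l = u" using dpsi_surj[OF assms(1)] .
  obtain l' where l': "l' \<in> D" "dpsi l' = u'" using dpsi_surj[of u'] assms by auto
  show ?thesis
  proof (cases "l = 0")
    case False
    then have "0 < l" using D_nonneg[OF l(1)] by simp
    then have "u * l - \<psi> l < u' * l - \<psi> l" using assms by simp
    then show ?thesis using psi_star_ge[of u' l] assms l psi_star_at_dpsi[OF l(1)] by simp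
  next
    case True
    then have u: "u = 0" using l by (simp add: dpsi)
    obtain m where m: "m \<in> D" "dpsi m = u' / 2" using dpsi_surj[of "u' / 2"] assms by auto
    have "0 < m" using m assms D_nonneg[OF m(1)] dpsi(3) by (cases "m = 0") auto
    moreover have "\<psi> m \<le> u' / 2 * m"
      using psi_above_tangent[OF m(1) zero_in_D] m by (simp add: psi_0)
    moreover have "u' * m - \<psi> m \<le> psi_star u'" using psi_star_ge[of u' m] assms m by simp
    moreover have "0 < u' * m" using \<open>0 < m\<close> assms by simp
    ultimately have "0 < psi_star u'" by simp
    then show ?thesis by (simp add: u psi_star_0)
  qed
qed

lemma psi_star_inj: "inj_on psi_star {0..}"
proof (rule inj_onI)
  fix u u' assume h: "u \<in> {0..}" "u' \<in> {0..}" "psi_star u = psi_star u'"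
  then show "u = u'"
    using psi_star_strict_mono[of u u'] psi_star_strict_mono[of u' u] by (cases u u' rule: linorder_cases) auto
qed

text \<open>The values \<open>l \<psi>'(l) - \<psi>(l)\<close> of the conjugate cover \<open>[0, \<infinity>)\<close>: they start at \<open>0\<close> and, by the tangent
  inequality at a fixed \<open>l\<^sub>0 > 0\<close>, dominate \<open>l\<^sub>0 \<psi>'(l) - \<psi>(l\<^sub>0)\<close>, which is unbounded by steepness.\<close>
lemma legendre_surj:
  assumes "0 \<le> y"
  obtains l where "l \<in> D" "dpsi l * l - \<psi> l = y"
proof -
  let ?q = "\<lambda>l. dpsi l * l - \<psi> l"
  obtain l0 where l0: "l0 \<in> D" "dpsi l0 = 1" using dpsi_surj[of 1] by auto
  have l0p: "0 < l0" using l0 D_nonneg[OF l0(1)] dpsi(3) by (cases "l0 = 0") auto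
  obtain b where b: "b \<in> D" "l0 \<le> b" "(y + \<psi> l0) / l0 \<le> dpsi b"
    using dpsi_unbounded[OF l0(1)] .
  have "y + \<psi> l0 \<le> dpsi b * l0" using b(3) l0p by (simp add: field_simps)
  then have qb: "y \<le> ?q b" using psi_above_tangent[OF b(1) l0(1)] by (simp add: algebra_simps)
  have sub: "{0..b} \<subseteq> D" using D_down[OF b(1)] by auto
  have "continuous_on D \<psi>" using dpsi(1) by (rule DERIV_continuous_on)
  then have "continuous_on D ?q" by (intro continuous_intros dpsi)
  then have "continuous_on {0..b} ?q" using sub continuous_on_subset by blast
  then obtain l where "0 \<le> l" "l \<le> b" "?q l = y"
    using IVT'[of ?q 0 y b] assms b qb l0p by (auto simp: dpsi psi_0)
  then show ?thesis using that D_down[OF b(1)] by blast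
qed

lemma psi_star_inv_at_legendre:
  assumes "l \<in> D"
  shows "psi_star_inv (dpsi l * l - \<psi> l) = dpsi l"
  unfolding convex_conj_inv_def psi_star_at_dpsi[OF assms, symmetric]
  using dpsi_nonneg[OF assms] by (intro inv_into_f_f psi_star_inj) auto

lemma
  assumes "0 \<le> y"
  shows psi_star_inv_nonneg: "0 \<le> psi_star_inv y" and psi_star_of_inv: "psi_star (psi_star_inv y) = y"
proof -
  obtain l where l: "l \<in> D" "dpsi l * l - \<psi> l = y" using legendre_surj[OF assms] .
  then show "0 \<le> psi_star_inv y" "psi_star (psi_star_inv y) = y"
    using psi_star_inv_at_legendre[OF l(1)] dpsi_nonneg[OF l(1)] psi_star_at_dpsi[OF l(1)] by auto
qed

lemma psi_star_inv_pos: "0 < y \<Longrightarrow> 0 < psi_star_inv y"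
  using psi_star_inv_nonneg[of y] psi_star_of_inv[of y] psi_star_0 by (cases "psi_star_inv y = 0") auto

text \<open>The inverse conjugate is the optimal Chernoff slope, the minimum over \<open>l\<close> of \<open>(\<psi>(l) + y) / l\<close>. The
  minimizer is the parameter at which the exponential process is used.\<close>
lemma psi_star_inv_attained:
  assumes "0 < y"
  obtains l where "l \<in> D" "0 < l" "\<psi> l + y = l * psi_star_inv y"
proof -
  obtain l where l: "l \<in> D" "dpsi l * l - \<psi> l = y" using legendre_surj[of y] assms by auto
  have "0 < l" using l assms D_nonneg[OF l(1)] by (cases "l = 0") (auto simp: psi_0)
  then show ?thesis using l psi_star_inv_at_legendre[OF l(1)] by (intro that[of l]) (auto simp: mult.commute)
qed

text \<open>Super-Gaussianity gives \<open>\<psi>(l) \<ge> c\<^sup>2 \<psi>(l / c)\<close> for \<open>c \<ge> 1\<close>, hence the conjugate grows at most quadratically and its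
  inverse at least like a square root.\<close>
lemma psi_star_scale:
  assumes c: "1 \<le> c" and u: "0 \<le> u"
  shows "psi_star (c * u) \<le> c\<^sup>2 * psi_star u"
  unfolding convex_conj_def[of _ _ "c * u"]
proof (rule cSUP_least)
  show "D \<noteq> {}" using zero_in_D by blast
  fix l assume l: "l \<in> D"
  have "1 * l \<le> c * l" using c D_nonneg[OF l] by (rule mult_right_mono)
  then have lcl: "l / c \<le> l" using c by (simp add: field_simps)
  then have lc: "l / c \<in> D" using D_down[OF l, of "l / c"] c D_nonneg[OF l] by simp
  have "c\<^sup>2 * \<psi> (l / c) \<le> \<psi> l"
  proof (cases "l = 0")
    case False
    then have "\<psi> (l / c) / (l / c)\<^sup>2 \<le> \<psi> l / l\<^sup>2"
      using super l lc lcl c unfolding super_gaussian_def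
      by (elim mono_onD) auto
    then show ?thesis using False c by (simp add: field_simps)
  qed (simp add: psi_0)
  moreover have "c\<^sup>2 * (u * (l / c) - \<psi> (l / c)) \<le> c\<^sup>2 * psi_star u"
    using psi_star_ge[OF u lc] by (intro mult_left_mono) auto
  moreover have "c\<^sup>2 * (u * (l / c)) = c * u * l" using c by (simp add: power2_eq_square)
  ultimately show "c * u * l - \<psi> l \<le> c\<^sup>2 * psi_star u" by (simp add: right_diff_distrib)
qed

lemma psi_star_inv_scale:
  assumes c: "1 \<le> c" and y: "0 \<le> y" and y': "c\<^sup>2 * y \<le> y'"
  shows "c * psi_star_inv y \<le> psi_star_inv y'"
proof (rule ccontr)
  assume "\<not> c * psi_star_inv y \<le> psi_star_inv y'"
  moreover have y'0: "0 \<le> y'" using y y' by (meson mult_nonneg_nonneg order_trans zero_le_power2)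
  ultimately have "psi_star (psi_star_inv y') < psi_star (c * psi_star_inv y)"
    using psi_star_inv_nonneg by (intro psi_star_strict_mono) auto
  also have "\<dots> \<le> c\<^sup>2 * psi_star (psi_star_inv y)" using psi_star_scale[OF c psi_star_inv_nonneg[OF y]] .
  finally show False using psi_star_of_inv[OF y] psi_star_of_inv[OF y'0] y' by simp
qed

lemma psi_star_inv_mono: "0 \<le> y \<Longrightarrow> y \<le> y' \<Longrightarrow> psi_star_inv y \<le> psi_star_inv y'"
  using psi_star_inv_scale[of 1 y y'] by simp

end

section \<open>Ville's inequality\<close>

text \<open>One step of Ville's argument: the mass of \<open>f\<close> on \<open>C\<close> pays for the part of \<open>C\<close> where the level \<open>a\<close>
  is reached, and the rest is carried over to the next time.\<close>
lemma (in finite_measure) markov_split: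
  fixes f :: "'a \<Rightarrow> real"
  assumes f: "integrable M f" and C: "C \<in> sets M" and pos: "\<And>x. x \<in> space M \<Longrightarrow> 0 \<le> f x"
  shows "(\<integral>x\<in>C \<inter> {x\<in>space M. f x < a}. f x \<partial>M) + a * measure M (C - {x\<in>space M. f x < a})
           \<le> (\<integral>x\<in>C. f x \<partial>M)"
proof -
  have [measurable]: "f \<in> borel_measurable M" "C \<in> sets M" using f C by auto
  let ?E = "{x\<in>space M. f x < a}"
  have E: "?E \<in> sets M" by measurable
  have i1: "set_integrable M (C \<inter> ?E) f"
    unfolding set_integrable_def using C E by (intro integrable_mult_indicator f) auto
  have i2: "set_integrable M (C - ?E) f"
    unfolding set_integrable_def using C E by (intro integrable_mult_indicator f) auto
  have i3: "set_integrable M (C - ?E) (\<lambda>_. a)"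
    unfolding set_integrable_def using C E by (intro integrable_mult_indicator integrable_const) auto
  have "(\<integral>x\<in>C. f x \<partial>M) = (\<integral>x\<in>(C \<inter> ?E) \<union> (C - ?E). f x \<partial>M)"
    by (intro arg_cong[where f="\<lambda>C. \<integral>x\<in>C. f x \<partial>M"]) auto
  also have "\<dots> = (\<integral>x\<in>C \<inter> ?E. f x \<partial>M) + (\<integral>x\<in>C - ?E. f x \<partial>M)"
    by (intro set_integral_Un i1 i2) auto
  finally have split: "(\<integral>x\<in>C. f x \<partial>M) = (\<integral>x\<in>C \<inter> ?E. f x \<partial>M) + (\<integral>x\<in>C - ?E. f x \<partial>M)" .
  have "(\<integral>x\<in>C - ?E. f x \<partial>M) \<ge> (\<integral>x\<in>C - ?E. a \<partial>M)"
    using sets.sets_into_space[OF C] by (intro set_integral_mono i2 i3) auto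
  moreover have "(\<integral>x\<in>C - ?E. a \<partial>M) = a * measure M (C - ?E)"
    using sets.sets_into_space[OF C]
    by (simp add: set_lebesgue_integral_def Int_absorb2 Diff_subset[THEN subset_trans])
  ultimately show ?thesis using split by simp
qed

text \<open>Let \<open>B n\<close> be the event that the level \<open>a\<close> has not been reached by time \<open>n\<close>. The mass of \<open>L n\<close> on
  \<open>B n\<close> plus \<open>a\<close> times the probability of the complement never exceeds the initial expectation: the
  supermartingale property moves the mass on \<open>B n\<close> to time \<open>n + 1\<close>, where Markov's inequality pays for
  the paths that reach the level at that time.\<close>
theorem ville_inequality:
  fixes L :: "nat \<Rightarrow> 'a \<Rightarrow> real"
  assumes "prob_space M" and filt: "filtration (space M) F" and sub: "\<And>t. subalgebra M (F t)"
    and sup: "supermartingale M F L" and pos: "\<And>t \<omega>. \<omega> \<in> space M \<Longrightarrow> 0 \<le> L t \<omega>"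
    and a: "0 < a"
  shows "measure M {\<omega>\<in>space M. \<exists>t. a \<le> L t \<omega>} \<le> (\<integral>\<omega>. L 0 \<omega> \<partial>M) / a"
proof -
  interpret prob_space M by fact
  interpret filtration "space M" F by fact
  have int: "integrable M (L t)" for t using sup by (simp add: supermartingale_def)
  have adapt: "L t \<in> borel_measurable (F t)" for t using sup by (simp add: supermartingale_def)
  define B where "B n = {\<omega>\<in>space M. \<forall>k\<le>n. L k \<omega> < a}" for n
  have BF: "B n \<in> sets (F n)" for n
  proof -
    have "{\<omega>\<in>space (F n). L k \<omega> < a} \<in> sets (F n)" if "k \<le> n" for k
    proof -
      have "{\<omega>\<in>space (F k). L k \<omega> < a} \<in> sets (F k)" using adapt[of k] by measurable
      then show ?thesis using sets_F_mono[OF that] by (auto simp: space_F)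
    qed
    then have "(\<Inter>k\<in>{..n}. {\<omega>\<in>space (F n). L k \<omega> < a}) \<in> sets (F n)"
      by (intro sets.finite_INT) auto
    also have "(\<Inter>k\<in>{..n}. {\<omega>\<in>space (F n). L k \<omega> < a}) = B n"
      by (auto simp: B_def space_F)
    finally show ?thesis .
  qed
  have BM: "B n \<in> sets M" for n using BF[of n] sub[of n] by (auto simp: subalgebra_def)
  have B_Suc: "B (Suc n) = B n \<inter> {\<omega>\<in>space M. L (Suc n) \<omega> < a}" for n
    by (auto simp: B_def le_Suc_eq)
  have step: "(\<integral>\<omega>\<in>B n. L (Suc n) \<omega> \<partial>M) \<le> (\<integral>\<omega>\<in>B n. L n \<omega> \<partial>M)" for n
  proof -
    interpret finite_measure_subalgebra M "F n" by unfold_locales (rule sub)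
    have "(\<integral>\<omega>\<in>B n. L (Suc n) \<omega> \<partial>M) = (\<integral>\<omega>\<in>B n. real_cond_exp M (F n) (L (Suc n)) \<omega> \<partial>M)"
      by (rule real_cond_exp_intA[OF int BF])
    also have "\<dots> \<le> (\<integral>\<omega>\<in>B n. L n \<omega> \<partial>M)"
    proof (rule set_integral_mono_AE)
      show "set_integrable M (B n) (real_cond_exp M (F n) (L (Suc n)))"
        unfolding set_integrable_def by (intro integrable_mult_indicator BM real_cond_exp_int int)
      show "set_integrable M (B n) (L n)"
        unfolding set_integrable_def by (intro integrable_mult_indicator BM int)
      have "AE \<omega> in M. real_cond_exp M (F n) (L (Suc n)) \<omega> \<le> L n \<omega>"
        using sup by (simp add: supermartingale_def)
      then show "AE \<omega>\<in>B n in M. real_cond_exp M (F n) (L (Suc n)) \<omega> \<le> L n \<omega>" by auto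
    qed
    finally show ?thesis .
  qed
  have main: "(\<integral>\<omega>\<in>B n. L n \<omega> \<partial>M) + a * measure M (space M - B n) \<le> (\<integral>\<omega>. L 0 \<omega> \<partial>M)" for n
  proof (induction n)
    case 0
    have "B 0 = space M \<inter> {\<omega>\<in>space M. L 0 \<omega> < a}" by (auto simp: B_def)
    moreover have "space M - B 0 = space M - {\<omega>\<in>space M. L 0 \<omega> < a}" by (auto simp: B_def)
    ultimately show ?case
      using markov_split[OF int sets.top pos, of 0 a] int[of 0] by (simp add: set_integral_space)
  next
    case (Suc n)
    have "measure M (space M - B (Suc n))
        = measure M ((space M - B n) \<union> (B n - {\<omega>\<in>space M. L (Suc n) \<omega> < a}))"
      using sets.sets_into_space[OF BM] by (intro arg_cong[where f="measure M"]) (auto simp: B_Suc)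
    also have "\<dots> \<le> measure M (space M - B n) + measure M (B n - {\<omega>\<in>space M. L (Suc n) \<omega> < a})"
      using BM int[of "Suc n"] by (intro measure_Un_le) auto
    finally have "a * measure M (space M - B (Suc n))
        \<le> a * measure M (space M - B n) + a * measure M (B n - {\<omega>\<in>space M. L (Suc n) \<omega> < a})"
      using a by (simp flip: distrib_left)
    then show ?case
      using Suc markov_split[OF int[of "Suc n"] BM[of n] pos, of a] step[of n] by (simp add: B_Suc)
  qed
  have "a * measure M (space M - B n) \<le> (\<integral>\<omega>. L 0 \<omega> \<partial>M)" for n
  proof -
    have "0 \<le> (\<integral>\<omega>\<in>B n. L n \<omega> \<partial>M)"
      unfolding set_lebesgue_integral_def using pos by (intro integral_nonneg_AE) (auto simp: indicator_def)
    then show ?thesis using main[of n] by linarith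
  qed
  then have bound: "measure M (space M - B n) \<le> (\<integral>\<omega>. L 0 \<omega> \<partial>M) / a" for n
    using a by (simp add: field_simps)
  have "(\<lambda>n. measure M (space M - B n)) \<longlonglongrightarrow> measure M (\<Union>n. space M - B n)"
  proof (rule finite_Lim_measure_incseq)
    show "range (\<lambda>n. space M - B n) \<subseteq> sets M" using BM by auto
    show "incseq (\<lambda>n. space M - B n)" by (rule incseq_SucI) (auto simp: B_Suc)
  qed
  then have "measure M (\<Union>n. space M - B n) \<le> (\<integral>\<omega>. L 0 \<omega> \<partial>M) / a"
    using bound by (intro LIMSEQ_le_const2) auto
  also have "(\<Union>n. space M - B n) = {\<omega>\<in>space M. \<exists>t. a \<le> L t \<omega>}"
    unfolding B_def by (auto simp: not_less) (meson not_le order_refl)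
  finally show ?thesis .
qed

section \<open>Covering numbers\<close>

lemma covering_number_attained:
  assumes "compact S" "0 < \<eta>"
  obtains K where "finite K" "card K = covering_number S \<eta>" "K \<subseteq> S"
    "\<forall>x\<in>S. \<exists>y\<in>K. dist x y \<le> \<eta>"
proof -
  have "S \<subseteq> (\<Union>x\<in>S. ball x \<eta>)" using assms(2) by auto
  then obtain K where K: "K \<subseteq> S" "finite K" "S \<subseteq> (\<Union>x\<in>K. ball x \<eta>)"
    using compactE_image[OF assms(1), of S "\<lambda>x. ball x \<eta>"] by auto
  have "\<forall>x\<in>S. \<exists>y\<in>K. dist x y \<le> \<eta>"
  proof
    fix x assume "x \<in> S"
    then obtain y where "y \<in> K" "x \<in> ball y \<eta>" using K(3) by auto
    then show "\<exists>y\<in>K. dist x y \<le> \<eta>" by (auto simp: dist_commute intro!: bexI[of _ y])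
  qed
  then have "\<exists>n K. finite K \<and> card K = n \<and> K \<subseteq> S \<and> (\<forall>x\<in>S. \<exists>y\<in>K. dist x y \<le> \<eta>)"
    using K by blast
  from LeastI_ex[OF this, folded covering_number_def] show ?thesis using that by blast
qed

lemma covering_number_antimono:
  assumes "compact S" "0 < \<eta>" "\<eta> \<le> \<eta>'"
  shows "covering_number S \<eta>' \<le> covering_number S \<eta>"
proof -
  obtain K where K: "finite K" "card K = covering_number S \<eta>" "K \<subseteq> S"
    "\<forall>x\<in>S. \<exists>y\<in>K. dist x y \<le> \<eta>"
    using covering_number_attained[OF assms(1,2)] .
  have "\<forall>x\<in>S. \<exists>y\<in>K. dist x y \<le> \<eta>'" using K(4) assms(3) by (meson order_trans)
  then show ?thesis using K unfolding covering_number_def[of S \<eta>'] by (intro Least_le exI[of _ K]) auto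
qed

lemma covering_number_pos:
  assumes "compact S" "0 < \<eta>" "S \<noteq> {}"
  shows "0 < covering_number S \<eta>"
proof -
  obtain K where "finite K" "card K = covering_number S \<eta>"
    "\<forall>x\<in>S. \<exists>y\<in>K. dist x y \<le> \<eta>"
    using covering_number_attained[OF assms(1,2)] .
  then show ?thesis using assms(3) by (metis card_gt_0_iff ex_in_conv)
qed

section \<open>Tests in single directions\<close>

text \<open>Write \<open>P\<close> and \<open>Q\<close> for the \<open>A\<close>-norms of the unit vectors \<open>p = s / \<bar>s\<bar>\<close> and \<open>\<nu>\<close>. By polarization
  \<open>2 (\<nu> \<bullet> A p) = P\<^sup>2 + Q\<^sup>2 - (\<nu> - p) \<bullet> A (\<nu> - p)\<close>, and the last term is at most \<open>\<epsilon>\<^sup>2 P Q\<close>, because the mesh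
  \<open>\<eta>\<close> compensates the condition number of \<open>A\<close> and both \<open>P\<close> and \<open>Q\<close> are at least the square root of
  the smallest eigenvalue. So testing a nearby direction loses only the factor \<open>1 - \<epsilon>\<close>.\<close>
lemma near_optimal_direction:
  fixes A :: "real^'n^'n"
  assumes sym: "transpose A = A" and g: "0 < eig_min A" and s: "s \<noteq> 0"
    and near: "norm (\<nu> - s /\<^sub>R norm s) \<le> \<eta>" and nu: "norm \<nu> = 1"
    and eta: "eig_max A * \<eta>\<^sup>2 \<le> eig_min A * \<epsilon>\<^sup>2" and eps: "0 < \<epsilon>" "\<epsilon> < 1"
  shows "(1 - \<epsilon>) * sqrt (s \<bullet> (A *v s)) * sqrt (\<nu> \<bullet> (A *v \<nu>)) \<le> \<nu> \<bullet> (A *v s)"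
proof -
  define p where "p = s /\<^sub>R norm s"
  have p1: "p \<bullet> p = 1" using s by (simp add: p_def power2_norm_eq_inner[symmetric] power2_eq_square)
  have nu1: "\<nu> \<bullet> \<nu> = 1" using nu by (simp add: power2_norm_eq_inner[symmetric])
  define P where "P = sqrt (p \<bullet> (A *v p))"
  define Q where "Q = sqrt (\<nu> \<bullet> (A *v \<nu>))"
  have gp: "eig_min A \<le> p \<bullet> (A *v p)" using eig_min_quad[OF sym, of p] p1 by simp
  have gn: "eig_min A \<le> \<nu> \<bullet> (A *v \<nu>)" using eig_min_quad[OF sym, of \<nu>] nu1 by simp
  have P2: "P\<^sup>2 = p \<bullet> (A *v p)" and Q2: "Q\<^sup>2 = \<nu> \<bullet> (A *v \<nu>)"
    using gp gn g by (simp_all add: P_def Q_def)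
  have PQ0: "0 \<le> P" "0 \<le> Q" using gp gn g by (simp_all add: P_def Q_def)
  have gPQ: "eig_min A \<le> P * Q"
  proof -
    have "eig_min A = sqrt (eig_min A) * sqrt (eig_min A)" using g by simp
    also have "\<dots> \<le> P * Q"
      unfolding P_def Q_def using gp gn g by (intro mult_mono real_sqrt_le_mono) auto
    finally show ?thesis .
  qed
  have mx: "0 \<le> eig_max A" using eig_min_le_eig_max[OF sym] g by simp
  have "(\<nu> - p) \<bullet> (A *v (\<nu> - p)) \<le> eig_max A * (norm (\<nu> - p))\<^sup>2"
    using eig_max_quad[OF sym] by (simp add: power2_norm_eq_inner)
  also have "\<dots> \<le> eig_max A * \<eta>\<^sup>2"
    using near mx unfolding p_def by (intro mult_left_mono power_mono) auto
  also have "\<dots> \<le> eig_min A * \<epsilon>\<^sup>2" by (rule eta)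
  also have "\<dots> \<le> P * Q * \<epsilon>\<^sup>2" using gPQ by (intro mult_right_mono) auto
  also have "\<dots> \<le> P * Q * (2 * \<epsilon>)"
  proof (intro mult_left_mono)
    have "\<epsilon> * \<epsilon> \<le> 1 * \<epsilon>" using eps by (intro mult_right_mono) auto
    then show "\<epsilon>\<^sup>2 \<le> 2 * \<epsilon>" using eps by (simp add: power2_eq_square)
  qed (use PQ0 in simp)
  finally have d: "(\<nu> - p) \<bullet> (A *v (\<nu> - p)) \<le> P * Q * (2 * \<epsilon>)" .
  have "(\<nu> - p) \<bullet> (A *v (\<nu> - p)) = Q\<^sup>2 - 2 * (\<nu> \<bullet> (A *v p)) + P\<^sup>2"
    using symmetric_inner[OF sym, of p \<nu>]
    by (simp add: P2 Q2 matrix_vector_mult_diff_distrib inner_diff_left inner_diff_right inner_commute)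
  moreover have "2 * P * Q \<le> P\<^sup>2 + Q\<^sup>2" by (rule sum_squares_bound)
  ultimately have key: "(1 - \<epsilon>) * P * Q \<le> \<nu> \<bullet> (A *v p)" using d by (simp add: algebra_simps)
  have "norm s *\<^sub>R p = s" using s by (simp add: p_def)
  then have sq: "s \<bullet> (A *v s) = (norm s)\<^sup>2 * (p \<bullet> (A *v p))" and "\<nu> \<bullet> (A *v s) = norm s * (\<nu> \<bullet> (A *v p))"
    by (metis inner_scaleR_left inner_scaleR_right matrix_vector_mult_scaleR mult.assoc power2_eq_square,
        metis inner_scaleR_right matrix_vector_mult_scaleR)
  then have "sqrt (s \<bullet> (A *v s)) = norm s * P" by (simp add: P_def real_sqrt_mult)
  moreover have "norm s * ((1 - \<epsilon>) * P * Q) \<le> norm s * (\<nu> \<bullet> (A *v p))"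
    using key by (intro mult_left_mono) auto
  ultimately show ?thesis
    using \<open>\<nu> \<bullet> (A *v s) = norm s * (\<nu> \<bullet> (A *v p))\<close> by (simp add: Q_def mult_ac)
qed

text \<open>The parameter \<open>l\<close> is tuned to the upper end \<open>m\<close> of an epoch that contains the actual variance \<open>a\<close>.
  This yields \<open>x < m \<cdot> (\<psi>\<^sup>*)\<^sup>-\<^sup>1(y / m)\<close>, and the square-root growth of the inverse conjugate replaces \<open>m\<close>
  by \<open>g\<close> at the cost of the factor \<open>\<alpha>\<close> in the argument:
  \<open>(\<psi>\<^sup>*)\<^sup>-\<^sup>1(\<alpha> y / g) \<ge> sqrt (\<alpha> m / g) \<cdot> (\<psi>\<^sup>*)\<^sup>-\<^sup>1(y / m)\<close> and \<open>m \<le> sqrt (\<alpha> a m)\<close>.\<close>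
lemma (in steep_super_gaussian) stitched_bound:
  assumes g: "0 < g" "g \<le> a" and a: "v \<le> a" "a \<le> m" "m \<le> \<alpha> * a"
    and y: "0 < y" "y \<le> y'"
    and l: "l \<in> D" "0 < l" "\<psi> l + y / m = l * psi_star_inv (y / m)"
    and x: "l * x - \<psi> l * v < y"
  shows "x < sqrt a * (sqrt g * psi_star_inv (\<alpha> / g * y'))"
proof -
  have m: "0 < m" using g a by simp
  have "0 < \<alpha>" using g a by (metis le_less_trans less_le_trans linorder_not_le mult_nonpos_nonneg less_imp_le)
  have "\<psi> l * v \<le> \<psi> l * m" using psi_nonneg[OF l(1)] a by (intro mult_left_mono) auto
  then have "l * x < m * (\<psi> l + y / m)" using x m by (simp add: distrib_left mult.commute)
  also have "\<dots> = l * (m * psi_star_inv (y / m))" using l(3) by simp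
  finally have 1: "x < m * psi_star_inv (y / m)" using l(2) by simp
  define c where "c = sqrt (\<alpha> * m / g)"
  have g1: "g * 1 \<le> m * \<alpha>"
  proof -
    have "1 \<le> \<alpha>"
      using g a by (metis dual_order.trans less_le_trans mult_le_cancel_right1 not_le)
    then show ?thesis using g a m by (intro mult_mono) auto
  qed
  have c1: "1 \<le> c" using g1 g by (simp add: c_def field_simps)
  have c2: "c\<^sup>2 * (y / m) = \<alpha> / g * y" using g m \<open>0 < \<alpha>\<close> by (simp add: c_def)
  have 2: "c * psi_star_inv (y / m) \<le> psi_star_inv (\<alpha> / g * y')"
  proof (rule psi_star_inv_scale[OF c1])
    show "c\<^sup>2 * (y / m) \<le> \<alpha> / g * y'"
      unfolding c2 using y g \<open>0 < \<alpha>\<close> by (intro mult_left_mono) auto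
  qed (use y m in simp)
  have pos: "0 < psi_star_inv (y / m)" using y m by (intro psi_star_inv_pos) simp
  have "m = sqrt m * sqrt m" using m by simp
  also have "\<dots> \<le> sqrt m * sqrt (\<alpha> * a)" using a by (intro mult_left_mono real_sqrt_le_mono) (use m in auto)
  also have "\<dots> = sqrt a * (sqrt g * c)"
    using g by (simp add: c_def real_sqrt_mult real_sqrt_divide)
  finally have "m * psi_star_inv (y / m) \<le> sqrt a * (sqrt g * c) * psi_star_inv (y / m)"
    using pos by (intro mult_right_mono) auto
  also have "\<dots> = sqrt a * (sqrt g * (c * psi_star_inv (y / m)))" by simp
  also have "\<dots> \<le> sqrt a * (sqrt g * psi_star_inv (\<alpha> / g * y'))"
    using 2 g by (intro mult_left_mono) auto
  finally show ?thesis using 1 by simp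
qed

lemma geometric_bracket:
  fixes b x :: real
  assumes "1 < b" "1 \<le> x"
  obtains j :: nat where "b ^ j \<le> x" "x < b ^ Suc j"
proof -
  obtain n where n: "x < b ^ n" using real_arch_pow[OF assms(1)] by blast
  define i where "i = (LEAST n. x < b ^ n)"
  have i: "x < b ^ i" unfolding i_def using n by (rule LeastI)
  then obtain j where j: "i = Suc j" using assms(2) by (cases i) auto
  have "\<not> x < b ^ j" using not_less_Least[of j "\<lambda>n. x < b ^ n"] j by (simp add: i_def)
  then show ?thesis using that[of j] i j by simp
qed

lemma geometric_bracket':
  fixes b x :: real
  assumes "1 < b" "1 \<le> x"
  obtains j :: nat where "x \<le> b ^ j" "b ^ j < b * x"
proof (cases "x = 1")
  case True
  then show ?thesis using that[of 0] assms by simp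
next
  case False
  obtain n where n: "b ^ n \<le> x" "x < b ^ Suc n" using geometric_bracket[OF assms] .
  show ?thesis
  proof (cases "b ^ n = x")
    case True
    then show ?thesis using that[of n] assms by simp
  next
    case False
    then show ?thesis using that[of "Suc n"] n assms by simp
  qed
qed

lemma (in finite_measure) measure_UN_le_suminf:
  assumes A: "\<And>i::nat. A i \<in> sets M" "\<And>i. measure M (A i) \<le> c i" and c: "summable c"
  shows "measure M (\<Union>i. A i) \<le> (\<Sum>i. c i)"
proof -
  have s: "summable (\<lambda>i. measure M (A i))"
    using A(2) by (intro summable_comparison_test'[OF c, of 0]) auto
  have "measure M (\<Union>i. A i) \<le> (\<Sum>i. measure M (A i))"
    using A(1) s by (intro finite_measure_subadditive_countably) auto
  also have "\<dots> \<le> (\<Sum>i. c i)" using A(2) s c by (intro suminf_le) auto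
  finally show ?thesis .
qed

section \<open>The self-normalized bound\<close>

text \<open>The logarithmic term as a function of the regularized matrix itself, so that one bound serves both
  \<open>V \<or> \<rho> I\<close> and \<open>V + \<rho> I\<close>.\<close>
definition confidence_level ::
    "real \<Rightarrow> real \<Rightarrow> real \<Rightarrow> real \<Rightarrow> real \<Rightarrow> (real \<Rightarrow> real) \<Rightarrow> real^'n^'n \<Rightarrow> real" where
  "confidence_level \<rho> \<alpha> \<beta> \<epsilon> \<delta> h A =
     ln (h (log \<alpha> (eig_max A / \<rho>)))
     + ln (1 / \<delta> * (1 / (1 - inverse \<beta>)))
     + ln (\<beta> * sqrt (cond_number A)
           * real (covering_number (sphere (0 :: real^'n) 1) (\<epsilon> / (\<beta> * sqrt (cond_number A)))))"

locale stitching = steep_super_gaussian +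
  fixes \<rho> \<alpha> \<beta> \<epsilon> \<delta> :: real and h :: "real \<Rightarrow> real"
  assumes rho: "0 < \<rho>" and alpha: "1 < \<alpha>" and beta: "1 < \<beta>"
    and eps: "0 < \<epsilon>" "\<epsilon> < 1" and delta: "0 < \<delta>" "\<delta> < 1"
    and h_pos: "\<And>x. 0 \<le> x \<Longrightarrow> 0 < h x" and h_mono: "mono_on {0..} h"
    and h_summable: "summable (\<lambda>k::nat. inverse (h (real k)))"
    and h_suminf: "(\<Sum>k::nat. inverse (h (real k))) \<le> 1"
begin

lemma h_ge_1: "1 \<le> h x" if "0 \<le> x"
proof -
  have "(\<Sum>k\<in>{0}. inverse (h (real k))) \<le> (\<Sum>k. inverse (h (real k)))"
    using h_pos by (intro sum_le_suminf h_summable) (auto intro: less_imp_le)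
  then have "inverse (h 0) \<le> 1" using h_suminf by simp
  then have "1 \<le> h 0" using h_pos[of 0] by (simp add: field_simps)
  also have "h 0 \<le> h x" using h_mono that by (auto intro: mono_onD)
  finally show ?thesis .
qed

lemma sphere_nonempty: "sphere (0::real^'n) 1 \<noteq> {}"
proof -
  obtain i :: 'n where True by simp
  have "axis i 1 \<in> sphere (0::real^'n) 1" by simp
  then show ?thesis by blast
qed

lemma delta_beta_gt_1: "1 < 1 / \<delta> * (1 / (1 - inverse \<beta>))"
proof -
  have "0 < 1 - inverse \<beta>" "1 - inverse \<beta> < 1" using beta by (auto simp: field_simps)
  then show ?thesis using delta less_1_mult[of "1 / \<delta>" "1 / (1 - inverse \<beta>)"] by simp
qed

text \<open>The dimension is passed as a type argument, since it shows in no other argument or value.\<close>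
definition net_size :: "'n::finite itself \<Rightarrow> nat \<Rightarrow> nat" where
  "net_size _ k = covering_number (sphere (0 :: real^'n) 1) (\<epsilon> / \<beta> ^ k)"

text \<open>The share of \<open>\<delta>\<close> spent on each direction of the \<open>k\<close>-th net in the \<open>j\<close>-th variance epoch. Summed over
  the directions, then over \<open>j\<close>, then over \<open>k\<close>, the shares add up to at most \<open>\<delta>\<close>. It is the exponential
  of minus the confidence level with \<open>\<alpha>\<^sup>j\<close> and \<open>\<beta>\<^sup>k\<close> in place of \<open>eig_max A / \<rho>\<close> and \<open>\<beta> sqrt \<kappa>(A)\<close>.\<close>
definition miss_prob :: "'n::finite itself \<Rightarrow> nat \<Rightarrow> nat \<Rightarrow> real" where
  "miss_prob n k j = inverse (h (real j) * (1 / \<delta> * (1 / (1 - inverse \<beta>))) * (\<beta> ^ k * real (net_size n k)))"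

lemma net_size_pos: "0 < net_size n k"
  unfolding net_size_def using eps beta sphere_nonempty by (intro covering_number_pos) auto

lemma inverse_miss_prob:
  "inverse (miss_prob n k j) = h (real j) * (1 / \<delta> * (1 / (1 - inverse \<beta>))) * (\<beta> ^ k * real (net_size n k))"
  by (simp add: miss_prob_def)

lemma inverse_miss_prob_gt_1: "1 < inverse (miss_prob n k j)"
proof -
  have "1 \<le> \<beta> ^ k * real (net_size n k)"
    using mult_mono[of 1 "\<beta> ^ k" 1 "real (net_size n k)"] beta net_size_pos[of n k]
    by (simp add: Suc_le_eq)
  moreover have "1 < h (real j) * (1 / \<delta> * (1 / (1 - inverse \<beta>)))"
    using mult_mono[of 1 "h (real j)" "1 / \<delta> * (1 / (1 - inverse \<beta>))" "1 / \<delta> * (1 / (1 - inverse \<beta>))"]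
      h_ge_1[of "real j"] delta_beta_gt_1 by linarith
  ultimately show ?thesis unfolding inverse_miss_prob
    by (smt (verit, best) mult_le_cancel_left1)
qed

lemma miss_prob_pos: "0 < miss_prob n k j"
  using inverse_miss_prob_gt_1[of n k j] by (metis inverse_positive_iff_positive less_trans zero_less_one)

lemma confidence_level_ge:
  fixes A :: "real^'n^'n"
  assumes sym: "transpose A = A" and A: "\<rho> \<le> eig_min A"
    and k: "\<beta> ^ k \<le> \<beta> * sqrt (cond_number A)" and j: "\<rho> * \<alpha> ^ j \<le> eig_max A"
  shows "ln (inverse (miss_prob TYPE('n) k j)) \<le> confidence_level \<rho> \<alpha> \<beta> \<epsilon> \<delta> h A"
proof -
  let ?K = "\<beta> * sqrt (cond_number A)"
  have bk: "0 < \<beta> ^ k" using beta by simp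
  have hj: "0 < h (real j)" using h_pos by simp
  have db: "0 < 1 / \<delta> * (1 / (1 - inverse \<beta>))" using delta_beta_gt_1 by linarith
  have "ln (inverse (miss_prob TYPE('n) k j))
      = ln (h (real j)) + ln (1 / \<delta> * (1 / (1 - inverse \<beta>))) + ln (\<beta> ^ k * real (net_size TYPE('n) k))"
    unfolding inverse_miss_prob using hj db bk net_size_pos[of "TYPE('n)" k]
    by (simp only: ln_mult_pos mult_pos_pos of_nat_0_less_iff)
  moreover have "ln (h (real j)) \<le> ln (h (log \<alpha> (eig_max A / \<rho>)))"
  proof -
    have "0 < \<alpha> ^ j" using alpha by simp
    moreover have "\<alpha> ^ j \<le> eig_max A / \<rho>" using j rho by (simp add: field_simps)
    moreover from calculation have "0 < eig_max A / \<rho>" by linarith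
    ultimately have "real j \<le> log \<alpha> (eig_max A / \<rho>)"
      using alpha by (subst le_log_iff) (auto simp: powr_realpow)
    then have "h (real j) \<le> h (log \<alpha> (eig_max A / \<rho>))" using h_mono by (auto intro: mono_onD)
    then show ?thesis using hj by simp
  qed
  moreover have "ln (\<beta> ^ k * real (net_size TYPE('n) k))
      \<le> ln (?K * real (covering_number (sphere (0 :: real^'n) 1) (\<epsilon> / ?K)))"
  proof -
    have K: "0 < ?K" using bk k by linarith
    have "net_size TYPE('n) k \<le> covering_number (sphere (0 :: real^'n) 1) (\<epsilon> / ?K)"
      unfolding net_size_def using bk k K eps by (intro covering_number_antimono) (auto simp: frac_le)
    then have "\<beta> ^ k * real (net_size TYPE('n) k)
        \<le> ?K * real (covering_number (sphere (0 :: real^'n) 1) (\<epsilon> / ?K))"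
      using k K by (intro mult_mono) auto
    then show ?thesis using bk net_size_pos[of "TYPE('n)" k] by (intro ln_mono) auto
  qed
  ultimately show ?thesis unfolding confidence_level_def by linarith
qed

lemma cond_number_ge_1:
  fixes A :: "real^'n^'n"
  assumes "transpose A = A" "\<rho> \<le> eig_min A"
  shows "1 \<le> cond_number A"
  using eig_min_le_eig_max[OF assms(1)] assms(2) rho by (simp add: cond_number_def)

lemma confidence_level_pos:
  fixes A :: "real^'n^'n"
  assumes sym: "transpose A = A" and A: "\<rho> \<le> eig_min A"
  shows "0 < confidence_level \<rho> \<alpha> \<beta> \<epsilon> \<delta> h A"
proof -
  have "1 \<le> sqrt (cond_number A)" using cond_number_ge_1[OF assms] by simp
  then have "1 * 1 \<le> \<beta> * sqrt (cond_number A)" using beta by (intro mult_mono) auto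
  then have "ln (inverse (miss_prob TYPE('n) 0 0)) \<le> confidence_level \<rho> \<alpha> \<beta> \<epsilon> \<delta> h A"
    using eig_min_le_eig_max[OF sym] A by (intro confidence_level_ge sym A) auto
  moreover have "0 < ln (inverse (miss_prob TYPE('n) 0 0))" using inverse_miss_prob_gt_1 by (rule ln_gt_zero)
  ultimately show ?thesis by linarith
qed

text \<open>The deterministic part of the argument. The vector \<open>s = A\<^sup>-\<^sup>1 S\<close> is the direction in which \<open>S\<close> is
  largest relative to the \<open>A\<close>-norm; a direction \<open>\<nu>\<close> of the net whose mesh matches the condition number
  is almost as good, and the exponential bound for \<open>\<nu>\<close>, at the parameter belonging to the epoch of
  \<open>\<nu> \<bullet> A \<nu>\<close>, controls \<open>\<nu> \<bullet> S\<close>. The matrix \<open>A\<close> is arbitrary above \<open>V\<close> and \<open>\<rho> I\<close>.\<close>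
lemma direction_bound:
  fixes A V :: "real^'n^'n" and S s :: "real^'n"
  assumes sym: "transpose A = A" and A: "\<rho> \<le> eig_min A"
    and VA: "\<And>x. x \<bullet> (V *v x) \<le> x \<bullet> (A *v x)" and s: "A *v s = S"
    and net: "\<And>k x. x \<in> sphere 0 1 \<Longrightarrow> \<exists>\<nu>\<in>net k. dist x \<nu> \<le> \<epsilon> / \<beta> ^ k"
    and net_sub: "\<And>k. net k \<subseteq> sphere 0 1"
    and l: "\<And>k j. l k j \<in> D" "\<And>k j. 0 < l k j"
      "\<And>k j. \<psi> (l k j) + ln (inverse (miss_prob TYPE('n) k j)) / (\<rho> * \<alpha> ^ Suc j)
         = l k j * psi_star_inv (ln (inverse (miss_prob TYPE('n) k j)) / (\<rho> * \<alpha> ^ Suc j))"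
    and good: "\<And>k j \<nu>. \<nu> \<in> net k \<Longrightarrow>
      exp (l k j * (\<nu> \<bullet> S) - \<psi> (l k j) * (\<nu> \<bullet> (V *v \<nu>))) < inverse (miss_prob TYPE('n) k j)"
  shows "sqrt (s \<bullet> S) < sqrt (eig_min A) / (1 - \<epsilon>)
      * psi_star_inv (\<alpha> / eig_min A * confidence_level \<rho> \<alpha> \<beta> \<epsilon> \<delta> h A)"
proof -
  let ?L = "confidence_level \<rho> \<alpha> \<beta> \<epsilon> \<delta> h A"
  let ?R = "sqrt (eig_min A) * psi_star_inv (\<alpha> / eig_min A * ?L)"
  have g: "0 < eig_min A" using A rho by simp
  have L: "0 < ?L" using confidence_level_pos[OF sym A] .
  have "0 < psi_star_inv (\<alpha> / eig_min A * ?L)" using L g alpha by (intro psi_star_inv_pos) simp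
  then have R: "0 < ?R" using g by simp
  have "(1 - \<epsilon>) * sqrt (s \<bullet> S) < ?R"
  \<comment> \<open>For \<open>s = 0\<close> there is no optimal direction, but the right-hand side is positive.\<close>
  proof (cases "s = 0")
    case True
    then show ?thesis using R by simp
  next
    case False
    have c1: "1 \<le> sqrt (cond_number A)" using cond_number_ge_1[OF sym A] by simp
    \<comment> \<open>The net is fine enough for the condition number, yet at most a factor \<open>\<beta>\<close> too fine.\<close>
    obtain k where k: "sqrt (cond_number A) \<le> \<beta> ^ k" "\<beta> ^ k < \<beta> * sqrt (cond_number A)"
      using geometric_bracket'[OF beta c1] .
    have "s /\<^sub>R norm s \<in> sphere 0 1" using False by simp
    from net[OF this, of k] obtain \<nu> where \<nu>: "\<nu> \<in> net k" "dist (s /\<^sub>R norm s) \<nu> \<le> \<epsilon> / \<beta> ^ k" by blast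
    have nu1: "norm \<nu> = 1" using net_sub[of k] \<nu>(1) by auto
    define a where "a = \<nu> \<bullet> (A *v \<nu>)"
    have nn: "\<nu> \<bullet> \<nu> = 1" using nu1 by (simp add: power2_norm_eq_inner[symmetric])
    have ga: "eig_min A \<le> a" "a \<le> eig_max A"
      using eig_min_quad[OF sym, of \<nu>] eig_max_quad[OF sym, of \<nu>] nn by (auto simp: a_def)
    have bk: "0 < \<beta> ^ k" using beta by simp
    have mesh: "eig_max A * (\<epsilon> / \<beta> ^ k)\<^sup>2 \<le> eig_min A * \<epsilon>\<^sup>2"
    proof -
      have "cond_number A = (sqrt (cond_number A))\<^sup>2" using cond_number_ge_1[OF sym A] by simp
      also have "\<dots> \<le> (\<beta> ^ k)\<^sup>2" using k(1) c1 by (intro power_mono) auto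
      finally have "eig_max A \<le> eig_min A * (\<beta> ^ k)\<^sup>2"
        using g by (simp add: cond_number_def field_simps)
      then have "eig_max A * \<epsilon>\<^sup>2 \<le> eig_min A * (\<beta> ^ k)\<^sup>2 * \<epsilon>\<^sup>2" by (rule mult_right_mono) simp
      moreover have "0 < (\<beta> ^ k)\<^sup>2" using bk by (rule zero_less_power)
      ultimately show ?thesis
        by (simp only: power_divide times_divide_eq_right pos_divide_le_eq mult_ac)
    qed
    have near: "(1 - \<epsilon>) * sqrt (s \<bullet> S) * sqrt a \<le> \<nu> \<bullet> S"
      using near_optimal_direction[OF sym g False _ nu1 mesh eps] \<nu>(2)
      by (simp add: a_def s dist_norm norm_minus_commute)
    have "1 \<le> a / \<rho>" using ga A rho by simp
    then obtain j where j: "\<alpha> ^ j \<le> a / \<rho>" "a / \<rho> < \<alpha> ^ Suc j"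
      using geometric_bracket[OF alpha] by blast
    have ja: "\<rho> * \<alpha> ^ j \<le> a" "a \<le> \<rho> * \<alpha> ^ Suc j" using j rho by (simp_all add: field_simps)
    let ?y = "ln (inverse (miss_prob TYPE('n) k j))"
    have "exp (l k j * (\<nu> \<bullet> S) - \<psi> (l k j) * (\<nu> \<bullet> (V *v \<nu>))) < exp ?y"
      using good[OF \<nu>(1), of j] miss_prob_pos[of "TYPE('n)" k j] by simp
    then have x: "l k j * (\<nu> \<bullet> S) - \<psi> (l k j) * (\<nu> \<bullet> (V *v \<nu>)) < ?y" by simp
    have "\<nu> \<bullet> S < sqrt a * ?R"
    proof (rule stitched_bound[OF g ga(1) _ _ _ _ _ l x])
      show "\<nu> \<bullet> (V *v \<nu>) \<le> a" using VA by (simp add: a_def)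
      show "a \<le> \<rho> * \<alpha> ^ Suc j" by (rule ja)
      show "\<rho> * \<alpha> ^ Suc j \<le> \<alpha> * a" using ja(1) alpha by (simp add: mult.left_commute)
      show "0 < ?y" using inverse_miss_prob_gt_1 by (rule ln_gt_zero)
      show "?y \<le> ?L" using ja(1) ga(2) k by (intro confidence_level_ge sym A) auto
    qed
    with near have "(1 - \<epsilon>) * sqrt (s \<bullet> S) * sqrt a < ?R * sqrt a" by (simp add: mult.commute)
    then show ?thesis using ga g by (auto simp: mult_less_cancel_right)
  qed
  then show ?thesis using eps by (simp add: field_simps)
qed

text \<open>Union bound over the countably many tests: Ville's inequality for the supermartingale of direction
  \<open>\<nu>\<close> and parameter \<open>l k j\<close>, at the level reciprocal to the share of \<open>\<delta>\<close> spent on it. The exceptional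
  event is chosen before \<open>A\<close>, so that it is the same for all times and all regularizations.\<close>
theorem self_normalized_bound:
  fixes S :: "nat \<Rightarrow> 'a \<Rightarrow> real^'n" and V :: "nat \<Rightarrow> 'a \<Rightarrow> real^'n^'n"
  assumes "prob_space M" and filt: "filtration (space M) F" and sub: "\<And>t. subalgebra M (F t)"
    and sub_psi: "sub_psi M F lmax \<psi> S V"
  obtains B where "B \<in> sets M" "measure M B \<le> \<delta>"
    "AE \<omega> in M. \<omega> \<notin> B \<longrightarrow> (\<forall>t A s. transpose A = A \<longrightarrow> \<rho> \<le> eig_min A \<longrightarrow>
       (\<forall>x. x \<bullet> (V t \<omega> *v x) \<le> x \<bullet> (A *v x)) \<longrightarrow> A *v s = S t \<omega> \<longrightarrow>
       sqrt (s \<bullet> S t \<omega>) < sqrt (eig_min A) / (1 - \<epsilon>)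
         * psi_star_inv (\<alpha> / eig_min A * confidence_level \<rho> \<alpha> \<beta> \<epsilon> \<delta> h A))"
proof -
  interpret prob_space M by fact
  let ?d = "miss_prob TYPE('n)"
  have "\<exists>K. finite K \<and> card K = net_size TYPE('n) k \<and> K \<subseteq> sphere (0::real^'n) 1 \<and>
      (\<forall>x\<in>sphere 0 1. \<exists>y\<in>K. dist x y \<le> \<epsilon> / \<beta> ^ k)" for k
    unfolding net_size_def
    by (rule covering_number_attained[of "sphere (0::real^'n) 1" "\<epsilon> / \<beta> ^ k"]) (use eps beta in auto)
  then obtain net where net: "\<And>k. finite (net k)" "\<And>k. card (net k) = net_size TYPE('n) k"
    "\<And>k. net k \<subseteq> sphere (0::real^'n) 1" "\<And>k. \<forall>x\<in>sphere 0 1. \<exists>y\<in>net k. dist x y \<le> \<epsilon> / \<beta> ^ k"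
    by metis
  have "\<exists>l. l \<in> D \<and> 0 < l \<and> \<psi> l + ln (inverse (?d k j)) / (\<rho> * \<alpha> ^ Suc j)
         = l * psi_star_inv (ln (inverse (?d k j)) / (\<rho> * \<alpha> ^ Suc j))" for k j
  proof -
    have "0 < ln (inverse (?d k j))" using inverse_miss_prob_gt_1 by (rule ln_gt_zero)
    then have "0 < ln (inverse (?d k j)) / (\<rho> * \<alpha> ^ Suc j)" using rho alpha by simp
    from psi_star_inv_attained[OF this] show ?thesis by metis
  qed
  then obtain l where l: "\<And>k j. l k j \<in> D" "\<And>k j. 0 < l k j"
      "\<And>k j. \<psi> (l k j) + ln (inverse (?d k j)) / (\<rho> * \<alpha> ^ Suc j)
         = l k j * psi_star_inv (ln (inverse (?d k j)) / (\<rho> * \<alpha> ^ Suc j))"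
    by metis
  define Q where "Q L \<nu> u \<longleftrightarrow> supermartingale M F L \<and> (\<forall>t. \<forall>\<omega>\<in>space M. 0 \<le> L t \<omega>) \<and>
      (\<integral>\<omega>. L 0 \<omega> \<partial>M) \<le> 1 \<and>
      (AE \<omega> in M. \<forall>t. exp (u * (\<nu> \<bullet> S t \<omega>) - \<psi> u * (\<nu> \<bullet> (V t \<omega> *v \<nu>))) \<le> L t \<omega>)" for L \<nu> u
  have "\<forall>\<nu>\<in>sphere 0 1. \<forall>u\<in>D. \<exists>L. Q L \<nu> u"
    using sub_psi unfolding sub_psi_def Q_def by blast
  then obtain L where L: "\<And>\<nu> u. \<nu> \<in> sphere 0 1 \<Longrightarrow> u \<in> D \<Longrightarrow> Q (L \<nu> u) \<nu> u" by metis
  define Bad where "Bad k j \<nu> = {\<omega>\<in>space M. \<exists>t. inverse (?d k j) \<le> L \<nu> (l k j) t \<omega>}" for k j \<nu>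
  have LQ: "Q (L \<nu> (l k j)) \<nu> (l k j)" if "\<nu> \<in> net k" for k j \<nu>
    using L[of \<nu> "l k j"] net(3)[of k] l(1) that by blast
  have Bad_meas: "Bad k j \<nu> \<in> sets M" if "\<nu> \<in> net k" for k j \<nu>
  proof -
    have "supermartingale M F (L \<nu> (l k j))" using LQ[OF that] by (simp add: Q_def)
    then have [measurable]: "L \<nu> (l k j) t \<in> borel_measurable M" for t
      by (auto simp: supermartingale_def)
    show ?thesis unfolding Bad_def by measurable
  qed
  have Bad_prob: "measure M (Bad k j \<nu>) \<le> ?d k j" if "\<nu> \<in> net k" for k j \<nu>
  proof -
    note q = LQ[OF that, of j, unfolded Q_def]
    have "measure M (Bad k j \<nu>) \<le> (\<integral>\<omega>. L \<nu> (l k j) 0 \<omega> \<partial>M) / inverse (?d k j)"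
      unfolding Bad_def
      using q miss_prob_pos[of "TYPE('n)" k j] by (intro ville_inequality[OF assms(1) filt sub]) auto
    also have "\<dots> \<le> 1 / inverse (?d k j)"
      using q miss_prob_pos[of "TYPE('n)" k j] by (intro divide_right_mono) auto
    finally show ?thesis by (simp add: divide_inverse)
  qed
  \<comment> \<open>The total share of \<open>\<delta>\<close> of the \<open>k\<close>-th net; the factor \<open>1 - 1 / \<beta>\<close> normalizes the geometric series.\<close>
  define c where "c k = \<delta> * (1 - inverse \<beta>) * inverse \<beta> ^ k" for k :: nat
  have c0: "0 \<le> c k" for k using delta beta by (simp add: c_def field_simps)
  define B1 where "B1 k j = (\<Union>\<nu>\<in>net k. Bad k j \<nu>)" for k j
  have B1: "B1 k j \<in> sets M" for k j unfolding B1_def using net(1) Bad_meas by (intro sets.finite_UN) auto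
  have "measure M (B1 k j) \<le> c k * inverse (h (real j))" for k j
  proof -
    have "measure M (B1 k j) \<le> (\<Sum>\<nu>\<in>net k. measure M (Bad k j \<nu>))"
      unfolding B1_def using net(1) Bad_meas by (intro measure_UNION_le) auto
    also have "\<dots> \<le> (\<Sum>\<nu>\<in>net k. ?d k j)" by (intro sum_mono Bad_prob)
    also have "\<dots> = real (net_size TYPE('n) k) * ?d k j" by (simp add: net)
    also have "\<dots> = c k * inverse (h (real j))"
    proof -
      have "n * inverse (x * (1 / \<delta> * (1 / b)) * (p * n)) = \<delta> * b * inverse p * inverse x"
        if "n \<noteq> 0" for n x b p :: real
        using that by (simp add: field_simps)
      then show ?thesis
        using net_size_pos[of "TYPE('n)" k] unfolding miss_prob_def c_def power_inverse
        by (simp add: divide_inverse mult_ac)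
    qed
    finally show ?thesis .
  qed
  note B1_prob = this
  define B2 where "B2 k = (\<Union>j. B1 k j)" for k
  have B2: "B2 k \<in> sets M" for k unfolding B2_def using B1 by auto
  have B2_prob: "measure M (B2 k) \<le> c k" for k
  proof -
    have "measure M (B2 k) \<le> (\<Sum>j. c k * inverse (h (real j)))"
      unfolding B2_def by (intro measure_UN_le_suminf B1 B1_prob summable_mult h_summable)
    also have "\<dots> = c k * (\<Sum>j. inverse (h (real j)))" by (rule suminf_mult[OF h_summable])
    also have "\<dots> \<le> c k * 1" using h_suminf c0 by (intro mult_left_mono) auto
    finally show ?thesis by simp
  qed
  define B where "B = (\<Union>k. B2 k)"
  have c_sums: "c sums \<delta>"
  proof -
    have "(\<lambda>k. inverse \<beta> ^ k) sums (1 / (1 - inverse \<beta>))"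
      using beta by (intro geometric_sums) (simp add: field_simps)
    from sums_mult[OF this, of "\<delta> * (1 - inverse \<beta>)"] show ?thesis
      using beta by (simp add: c_def[abs_def])
  qed
  show ?thesis
  proof (rule that[of B])
    show "B \<in> sets M" unfolding B_def using B2 by auto
    have "measure M B \<le> (\<Sum>k. c k)"
      unfolding B_def using c_sums by (intro measure_UN_le_suminf B2 B2_prob) (simp add: sums_iff)
    then show "measure M B \<le> \<delta>" using c_sums by (simp add: sums_iff)
    have "AE \<omega> in M. \<forall>k j. \<forall>\<nu>\<in>net k. \<forall>t.
        exp (l k j * (\<nu> \<bullet> S t \<omega>) - \<psi> (l k j) * (\<nu> \<bullet> (V t \<omega> *v \<nu>))) \<le> L \<nu> (l k j) t \<omega>"
      unfolding AE_all_countable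
    proof (intro allI AE_finite_allI net(1))
      fix k j \<nu> assume "\<nu> \<in> net k"
      then show "AE \<omega> in M. \<forall>t. exp (l k j * (\<nu> \<bullet> S t \<omega>) - \<psi> (l k j) * (\<nu> \<bullet> (V t \<omega> *v \<nu>))) \<le> L \<nu> (l k j) t \<omega>"
        using LQ[of \<nu> k j] unfolding Q_def by blast
    qed
    with AE_space show "AE \<omega> in M. \<omega> \<notin> B \<longrightarrow> (\<forall>t A s. transpose A = A \<longrightarrow> \<rho> \<le> eig_min A \<longrightarrow>
       (\<forall>x. x \<bullet> (V t \<omega> *v x) \<le> x \<bullet> (A *v x)) \<longrightarrow> A *v s = S t \<omega> \<longrightarrow>
       sqrt (s \<bullet> S t \<omega>) < sqrt (eig_min A) / (1 - \<epsilon>)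
         * psi_star_inv (\<alpha> / eig_min A * confidence_level \<rho> \<alpha> \<beta> \<epsilon> \<delta> h A))"
    proof (eventually_elim, intro impI allI)
      fix \<omega> t A s
      assume \<omega>: "\<omega> \<in> space M" "\<forall>k j. \<forall>\<nu>\<in>net k. \<forall>t.
          exp (l k j * (\<nu> \<bullet> S t \<omega>) - \<psi> (l k j) * (\<nu> \<bullet> (V t \<omega> *v \<nu>))) \<le> L \<nu> (l k j) t \<omega>" "\<omega> \<notin> B"
        and A: "transpose A = A" "\<rho> \<le> eig_min A" "\<forall>x. x \<bullet> (V t \<omega> *v x) \<le> x \<bullet> (A *v x)" "A *v s = S t \<omega>"
      show "sqrt (s \<bullet> S t \<omega>) < sqrt (eig_min A) / (1 - \<epsilon>)
         * psi_star_inv (\<alpha> / eig_min A * confidence_level \<rho> \<alpha> \<beta> \<epsilon> \<delta> h A)"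
      proof (rule direction_bound[OF A(1,2) _ A(4) _ net(3) l])
        show "x \<bullet> (V t \<omega> *v x) \<le> x \<bullet> (A *v x)" for x using A(3) by blast
        show "\<exists>\<nu>\<in>net k. dist x \<nu> \<le> \<epsilon> / \<beta> ^ k" if "x \<in> sphere 0 1" for k x using net(4) that by blast
        fix k j \<nu> assume \<nu>: "\<nu> \<in> net k"
        have "exp (l k j * (\<nu> \<bullet> S t \<omega>) - \<psi> (l k j) * (\<nu> \<bullet> (V t \<omega> *v \<nu>))) \<le> L \<nu> (l k j) t \<omega>"
          using \<omega>(2) \<nu> by blast
        also have "\<omega> \<notin> Bad k j \<nu>" using \<omega>(3) \<nu> by (auto simp: B_def B2_def B1_def)
        then have "L \<nu> (l k j) t \<omega> < inverse (?d k j)" using \<omega>(1) by (auto simp: Bad_def not_le)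
        finally show "exp (l k j * (\<nu> \<bullet> S t \<omega>) - \<psi> (l k j) * (\<nu> \<bullet> (V t \<omega> *v \<nu>))) < inverse (?d k j)" .
      qed
    qed
  qed
qed

end

section \<open>Measurability\<close>

lemma borel_measurable_vecI:
  fixes f :: "'a \<Rightarrow> real^'n"
  assumes "\<And>i. (\<lambda>\<omega>. f \<omega> $ i) \<in> borel_measurable M"
  shows "f \<in> borel_measurable M"
  using assms by (subst borel_measurable_euclidean_space) (auto simp: Basis_vec_def inner_axis)

lemma borel_measurable_vec_component [measurable]:
  fixes f :: "'a \<Rightarrow> ('b::euclidean_space)^'n"
  assumes "f \<in> borel_measurable M"
  shows "(\<lambda>\<omega>. f \<omega> $ i) \<in> borel_measurable M"
  by (rule borel_measurable_continuous_on[OF _ assms]) (intro continuous_intros)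

lemma borel_measurable_matrix_vector_mult [measurable]:
  fixes A :: "'a \<Rightarrow> real^'n^'m"
  assumes [measurable]: "A \<in> borel_measurable M" "x \<in> borel_measurable M"
  shows "(\<lambda>\<omega>. A \<omega> *v x \<omega>) \<in> borel_measurable M"
  by (rule borel_measurable_vecI) (simp add: matrix_vector_mult_def)

text \<open>Cramer's rule expresses the solution of a linear system by finitely many arithmetic operations.\<close>
lemma borel_measurable_matrix_inv_mult:
  fixes A :: "'a \<Rightarrow> real^'n^'n"
  assumes [measurable]: "A \<in> borel_measurable M" "b \<in> borel_measurable M"
    and inv: "\<And>\<omega>. \<omega> \<in> space M \<Longrightarrow> invertible (A \<omega>)"
  shows "(\<lambda>\<omega>. matrix_inv (A \<omega>) *v b \<omega>) \<in> borel_measurable M"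
proof -
  have "matrix_inv (A \<omega>) *v b \<omega>
      = (\<chi> k. det (\<chi> i j. if j = k then b \<omega> $ i else A \<omega> $ i $ j) / det (A \<omega>))"
    if "\<omega> \<in> space M" for \<omega>
    using cramer[of "A \<omega>"] inv[OF that] matrix_inv_mult_cancel(1)[OF inv[OF that]]
    by (auto simp: invertible_det_nz)
  moreover have "(\<lambda>\<omega>. \<chi> k. det (\<chi> i j. if j = k then b \<omega> $ i else A \<omega> $ i $ j) / det (A \<omega>))
      \<in> borel_measurable M"
    unfolding det_def by (rule borel_measurable_vecI) simp
  ultimately show ?thesis by (subst measurable_cong) auto
qed

lemma borel_measurable_eig_min:
  fixes A :: "'a \<Rightarrow> real^'n^'n"
  assumes A: "A \<in> borel_measurable M" and sym: "\<And>\<omega>. \<omega> \<in> space M \<Longrightarrow> transpose (A \<omega>) = A \<omega>"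
  shows "(\<lambda>\<omega>. eig_min (A \<omega>)) \<in> borel_measurable M"
  unfolding borel_measurable_iff_ge
proof
  fix a
  have "closed (\<Inter>x. {W::real^'n^'n. a * (x \<bullet> x) \<le> x \<bullet> (W *v x)})"
    by (intro closed_INT ballI closed_Collect_le continuous_intros continuous_quad)
  then have "A -` (\<Inter>x. {W. a * (x \<bullet> x) \<le> x \<bullet> (W *v x)}) \<inter> space M \<in> sets M"
    by (intro measurable_sets[OF A] borel_closed)
  also have "A -` (\<Inter>x. {W. a * (x \<bullet> x) \<le> x \<bullet> (W *v x)}) \<inter> space M = {\<omega>\<in>space M. a \<le> eig_min (A \<omega>)}"
    using le_eig_min_iff[OF sym] by auto
  finally show "{\<omega>\<in>space M. a \<le> eig_min (A \<omega>)} \<in> sets M" .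
qed

lemma borel_measurable_eig_max:
  fixes A :: "'a \<Rightarrow> real^'n^'n"
  assumes A: "A \<in> borel_measurable M" and sym: "\<And>\<omega>. \<omega> \<in> space M \<Longrightarrow> transpose (A \<omega>) = A \<omega>"
  shows "(\<lambda>\<omega>. eig_max (A \<omega>)) \<in> borel_measurable M"
  unfolding borel_measurable_iff_le
proof
  fix a
  have "closed (\<Inter>x. {W::real^'n^'n. x \<bullet> (W *v x) \<le> a * (x \<bullet> x)})"
    by (intro closed_INT ballI closed_Collect_le continuous_intros continuous_quad)
  then have "A -` (\<Inter>x. {W. x \<bullet> (W *v x) \<le> a * (x \<bullet> x)}) \<inter> space M \<in> sets M"
    by (intro measurable_sets[OF A] borel_closed)
  also have "A -` (\<Inter>x. {W. x \<bullet> (W *v x) \<le> a * (x \<bullet> x)}) \<inter> space M = {\<omega>\<in>space M. eig_max (A \<omega>) \<le> a}"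
    using eig_max_le_iff[OF sym] by auto
  finally show "{\<omega>\<in>space M. eig_max (A \<omega>) \<le> a} \<in> sets M" .
qed

lemma borel_measurable_mat_max:
  fixes A :: "'a \<Rightarrow> real^'n^'n"
  assumes A: "A \<in> borel_measurable M" and sym: "\<And>\<omega>. \<omega> \<in> space M \<Longrightarrow> transpose (A \<omega>) = A \<omega>"
  shows "(\<lambda>\<omega>. mat_max (A \<omega>) \<rho>) \<in> borel_measurable M"
proof -
  have t0: "transpose (0::real^'n^'n) = 0" by (simp add: transpose_def vec_eq_iff)
  have "(\<lambda>\<omega>. closest_point (symmetric_above \<rho>) (A \<omega>)) \<in> borel_measurable M"
    using mat_max_eq_closest_point(2-4)[OF t0]
    by (intro borel_measurable_continuous_on[OF _ A] continuous_on_closest_point)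
  then show ?thesis
    using mat_max_eq_closest_point(1)[OF sym] by (subst measurable_cong) auto
qed

text \<open>The functions \<open>h\<close>, the covering number and the inverse conjugate come without any explicit form;
  monotonicity makes them measurable.\<close>
lemma borel_measurable_mono_on_nonneg:
  fixes f :: "real \<Rightarrow> real"
  assumes f: "mono_on {0..} f" and x: "x \<in> borel_measurable M" and pos: "\<And>\<omega>. \<omega> \<in> space M \<Longrightarrow> 0 \<le> x \<omega>"
  shows "(\<lambda>\<omega>. f (x \<omega>)) \<in> borel_measurable M"
proof -
  have "mono (\<lambda>u. f (max 0 u))" by (intro monoI mono_onD[OF f]) auto
  then have "(\<lambda>u. f (max 0 u)) \<in> borel_measurable borel" by (rule borel_measurable_mono)
  then have "(\<lambda>\<omega>. f (max 0 (x \<omega>))) \<in> borel_measurable M" using x by (rule measurable_compose[rotated])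
  then show ?thesis using pos by (subst measurable_cong) (auto simp: max_absorb2)
qed

context stitching
begin

lemma borel_measurable_confidence_level:
  fixes A :: "'a \<Rightarrow> real^'n^'n"
  assumes A [measurable]: "A \<in> borel_measurable M"
    and sym: "\<And>\<omega>. \<omega> \<in> space M \<Longrightarrow> transpose (A \<omega>) = A \<omega>"
    and ge: "\<And>\<omega>. \<omega> \<in> space M \<Longrightarrow> \<rho> \<le> eig_min (A \<omega>)"
  shows "(\<lambda>\<omega>. confidence_level \<rho> \<alpha> \<beta> \<epsilon> \<delta> h (A \<omega>)) \<in> borel_measurable M"
proof -
  have [measurable]: "(\<lambda>\<omega>. eig_max (A \<omega>)) \<in> borel_measurable M" "(\<lambda>\<omega>. eig_min (A \<omega>)) \<in> borel_measurable M"
    using borel_measurable_eig_max[OF A sym] borel_measurable_eig_min[OF A sym] by auto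
  have [measurable]: "(\<lambda>\<omega>. h (log \<alpha> (eig_max (A \<omega>) / \<rho>))) \<in> borel_measurable M"
  proof (rule borel_measurable_mono_on_nonneg[OF h_mono])
    show "0 \<le> log \<alpha> (eig_max (A \<omega>) / \<rho>)" if "\<omega> \<in> space M" for \<omega>
      using ge[OF that] eig_min_le_eig_max[OF sym[OF that]] rho alpha by simp
  qed measurable
  have [measurable]: "(\<lambda>\<omega>. cond_number (A \<omega>)) \<in> borel_measurable M"
    unfolding cond_number_def by measurable
  \<comment> \<open>Shifting the condition number by \<open>1\<close> lets the covering number be a monotone function on \<open>[0, \<infinity>)\<close>.\<close>
  let ?N = "\<lambda>u. real (covering_number (sphere (0::real^'n) 1) (\<epsilon> / (\<beta> * sqrt (u + 1))))"
  have "mono_on {0..} ?N"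
  proof (rule mono_onI)
    fix u u' :: real assume u: "u \<in> {0..}" "u \<le> u'"
    have "0 < \<beta> * sqrt (u + 1)" "\<beta> * sqrt (u + 1) \<le> \<beta> * sqrt (u' + 1)" using u beta by auto
    then show "?N u \<le> ?N u'" using eps u beta
      by (intro of_nat_mono covering_number_antimono) (auto intro!: divide_left_mono)
  qed
  then have "(\<lambda>\<omega>. ?N (cond_number (A \<omega>) - 1)) \<in> borel_measurable M"
  proof (rule borel_measurable_mono_on_nonneg)
    show "0 \<le> cond_number (A \<omega>) - 1" if "\<omega> \<in> space M" for \<omega>
      using cond_number_ge_1[OF sym[OF that] ge[OF that]] by simp
  qed measurable
  then have [measurable]: "(\<lambda>\<omega>. real (covering_number (sphere (0::real^'n) 1)
      (\<epsilon> / (\<beta> * sqrt (cond_number (A \<omega>)))))) \<in> borel_measurable M" by simp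
  show ?thesis unfolding confidence_level_def by measurable
qed

definition radius :: "real^'n^'n \<Rightarrow> real" where
  "radius A = sqrt (eig_min A) / (1 - \<epsilon>)
     * psi_star_inv (\<alpha> / eig_min A * confidence_level \<rho> \<alpha> \<beta> \<epsilon> \<delta> h A)"

lemma borel_measurable_radius:
  fixes A :: "'a \<Rightarrow> real^'n^'n"
  assumes A: "A \<in> borel_measurable M"
    and sym: "\<And>\<omega>. \<omega> \<in> space M \<Longrightarrow> transpose (A \<omega>) = A \<omega>"
    and ge: "\<And>\<omega>. \<omega> \<in> space M \<Longrightarrow> \<rho> \<le> eig_min (A \<omega>)"
  shows "(\<lambda>\<omega>. radius (A \<omega>)) \<in> borel_measurable M"
proof -
  note [measurable] = borel_measurable_eig_min[OF A sym] borel_measurable_confidence_level[OF A sym ge]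
  have "mono_on {0..} psi_star_inv" by (intro mono_onI psi_star_inv_mono) auto
  then have [measurable]: "(\<lambda>\<omega>. psi_star_inv (\<alpha> / eig_min (A \<omega>) * confidence_level \<rho> \<alpha> \<beta> \<epsilon> \<delta> h (A \<omega>)))
      \<in> borel_measurable M"
  proof (rule borel_measurable_mono_on_nonneg)
    show "0 \<le> \<alpha> / eig_min (A \<omega>) * confidence_level \<rho> \<alpha> \<beta> \<epsilon> \<delta> h (A \<omega>)" if "\<omega> \<in> space M" for \<omega>
      using ge[OF that] rho alpha confidence_level_pos[OF sym[OF that] ge[OF that]] by simp
  qed measurable
  show ?thesis unfolding radius_def by measurable
qed

end

section \<open>Confidence ellipsoids for regularized least squares\<close>

text \<open>In the common eigenbasis the squared norm is the sum of \<open>(a\<^sub>i - c\<^sub>i)\<^sup>2 / a\<^sub>i\<close> times the squared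
  coordinates of \<open>x\<close>.\<close>
lemma regularization_bias:
  fixes V A :: "real^'n^'n"
  assumes V: "spectral_decomposition V c v" and A: "spectral_decomposition A a v"
    and a: "\<And>i. 0 < a i" and K: "\<And>i. (a i - c i)\<^sup>2 \<le> K * a i"
  shows "norm (mat_sqrt A *v (matrix_inv A *v ((A - V) *v x))) \<le> sqrt K * norm x"
proof -
  have on: "orthonormal_family v" using V by (simp add: spectral_decomposition_iff)
  have sym: "transpose A = A" using A by (rule spectral_decomposition_symmetric)
  have pos: "0 < eig_min A" using a by (simp add: eig_min_def eigenvalues_eq_range[OF A])
  define w where "w = (\<Sum>i\<in>UNIV. ((a i - c i) / a i * (v i \<bullet> x)) *\<^sub>R v i)"
  have vw: "v i \<bullet> w = (a i - c i) / a i * (v i \<bullet> x)" for i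
    by (simp add: w_def orthonormal_coefficient[OF on])
  have "A *v w = (A - V) *v x"
  proof -
    have "A *v w = (\<Sum>i\<in>UNIV. (a i * (v i \<bullet> w)) *\<^sub>R v i)"
      using A by (simp only: spectral_decomposition_iff spectral_sum_mult)
    also have "\<dots> = (\<Sum>i\<in>UNIV. (a i * (v i \<bullet> x)) *\<^sub>R v i) - (\<Sum>i\<in>UNIV. (c i * (v i \<bullet> x)) *\<^sub>R v i)"
      unfolding sum_subtractf[symmetric] scaleR_diff_left[symmetric]
    proof (rule sum.cong[OF refl])
      fix i
      have "a i * (v i \<bullet> w) = a i * (v i \<bullet> x) - c i * (v i \<bullet> x)"
        unfolding vw using a[of i] by (simp add: left_diff_distrib)
      then show "(a i * (v i \<bullet> w)) *\<^sub>R v i = (a i * (v i \<bullet> x) - c i * (v i \<bullet> x)) *\<^sub>R v i" by simp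
    qed
    also have "\<dots> = A *v x - V *v x"
      using A V by (simp only: spectral_decomposition_iff spectral_sum_mult)
    finally show ?thesis by (simp add: matrix_vector_mult_diff_rdistrib)
  qed
  then have w: "matrix_inv A *v ((A - V) *v x) = w"
    using matrix_inv_mult_cancel(2)[OF invertible_if_eig_min_pos[OF sym pos], of w] by simp
  have "w \<bullet> (A *v w) = (\<Sum>i\<in>UNIV. a i * (v i \<bullet> w)\<^sup>2)" by (rule spectral_decomposition_quad[OF A])
  also have "\<dots> \<le> (\<Sum>i\<in>UNIV. K * (v i \<bullet> x)\<^sup>2)"
  proof (rule sum_mono)
    fix i
    have "a i * (v i \<bullet> w)\<^sup>2 = (a i - c i)\<^sup>2 / a i * (v i \<bullet> x)\<^sup>2"
      using a[of i] by (simp add: vw power_mult_distrib power_divide power2_eq_square)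
    also have "\<dots> \<le> K * (v i \<bullet> x)\<^sup>2"
      using K[of i] a[of i] by (intro mult_right_mono) (auto simp: pos_divide_le_eq)
    finally show "a i * (v i \<bullet> w)\<^sup>2 \<le> K * (v i \<bullet> x)\<^sup>2" .
  qed
  also have "\<dots> = K * (norm x)\<^sup>2"
    by (simp add: sum_distrib_left[symmetric] norm_sq_orthonormal[OF on, symmetric] power2_norm_eq_inner)
  finally have "sqrt (w \<bullet> (A *v w)) \<le> sqrt (K * (norm x)\<^sup>2)" by (rule real_sqrt_le_mono)
  moreover have "psd A" using sym pos by (simp add: psd_iff_eig_min)
  ultimately show ?thesis by (simp add: w norm_mat_sqrt real_sqrt_mult)
qed

text \<open>The estimation error splits as \<open>A\<^sup>-\<^sup>1 (V \<theta> + S) - \<theta> = A\<^sup>-\<^sup>1 S - A\<^sup>-\<^sup>1 (A - V) \<theta>\<close>. The \<open>A\<close>-norm of the first part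
  is bounded by the self-normalized bound, that of the second by the bias assumption. Since a
  non-measurable set has measure \<open>0\<close>, the measurability of the event is part of the claim.\<close>
lemma (in stitching) regularized_confidence_ellipsoid:
  fixes S :: "nat \<Rightarrow> 'a \<Rightarrow> real^'n" and V A :: "nat \<Rightarrow> 'a \<Rightarrow> real^'n^'n"
  assumes "prob_space M" and filt: "filtration (space M) F" and sub: "\<And>t. subalgebra M (F t)"
    and sub_psi: "sub_psi M F lmax \<psi> S V"
    and A: "\<And>t. A t \<in> borel_measurable M"
    and sym: "\<And>t \<omega>. \<omega> \<in> space M \<Longrightarrow> transpose (A t \<omega>) = A t \<omega>"
    and ge: "\<And>t \<omega>. \<omega> \<in> space M \<Longrightarrow> \<rho> \<le> eig_min (A t \<omega>)"
    and VA: "\<And>t \<omega> x. \<omega> \<in> space M \<Longrightarrow> x \<bullet> (V t \<omega> *v x) \<le> x \<bullet> (A t \<omega> *v x)"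
    and b: "\<And>t. b t \<in> borel_measurable M"
    and bias: "\<And>t \<omega>. \<omega> \<in> space M \<Longrightarrow>
      norm (mat_sqrt (A t \<omega>) *v (matrix_inv (A t \<omega>) *v ((A t \<omega> - V t \<omega>) *v \<theta>))) \<le> b t \<omega>"
  shows "1 - \<delta> \<le> measure M {\<omega>\<in>space M. \<forall>t\<ge>1.
      norm (mat_sqrt (A t \<omega>) *v (matrix_inv (A t \<omega>) *v (V t \<omega> *v \<theta> + S t \<omega>) - \<theta>))
      < radius (A t \<omega>) + b t \<omega>}"
proof -
  interpret prob_space M by fact
  let ?G = "{\<omega>\<in>space M. \<forall>t\<ge>1.
      norm (mat_sqrt (A t \<omega>) *v (matrix_inv (A t \<omega>) *v (V t \<omega> *v \<theta> + S t \<omega>) - \<theta>))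
      < radius (A t \<omega>) + b t \<omega>}"
  have psd: "psd (A t \<omega>)" and inv: "invertible (A t \<omega>)" if "\<omega> \<in> space M" for t \<omega>
    using sym[OF that, of t] ge[OF that, of t] rho
    by (auto simp: psd_iff_eig_min intro!: invertible_if_eig_min_pos)
  have meas [measurable]: "?G \<in> sets M"
  proof -
    have [measurable]: "S t \<in> borel_measurable M" "V t \<in> borel_measurable M" for t
      using sub_psi sub[of t] measurable_from_subalg[OF sub[of t]] unfolding sub_psi_def by auto
    note [measurable] = A b borel_measurable_radius[OF A sym ge]
    have [measurable]: "(\<lambda>\<omega>. norm (mat_sqrt (A t \<omega>) *v (matrix_inv (A t \<omega>) *v (V t \<omega> *v \<theta> + S t \<omega>) - \<theta>)))
        \<in> borel_measurable M" for t
    proof -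
      have [measurable]: "(\<lambda>\<omega>. matrix_inv (A t \<omega>) *v (V t \<omega> *v \<theta> + S t \<omega>)) \<in> borel_measurable M"
        using inv by (intro borel_measurable_matrix_inv_mult) auto
      have "(\<lambda>\<omega>. sqrt ((matrix_inv (A t \<omega>) *v (V t \<omega> *v \<theta> + S t \<omega>) - \<theta>) \<bullet>
          (A t \<omega> *v (matrix_inv (A t \<omega>) *v (V t \<omega> *v \<theta> + S t \<omega>) - \<theta>)))) \<in> borel_measurable M"
        by measurable
      then show ?thesis using norm_mat_sqrt[OF psd] by (subst measurable_cong) auto
    qed
    show ?thesis by measurable
  qed
  obtain B where B: "B \<in> sets M" "measure M B \<le> \<delta>"
    and good: "AE \<omega> in M. \<omega> \<notin> B \<longrightarrow> (\<forall>t A s. transpose A = A \<longrightarrow> \<rho> \<le> eig_min A \<longrightarrow>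
       (\<forall>x. x \<bullet> (V t \<omega> *v x) \<le> x \<bullet> (A *v x)) \<longrightarrow> A *v s = S t \<omega> \<longrightarrow>
       sqrt (s \<bullet> S t \<omega>) < sqrt (eig_min A) / (1 - \<epsilon>)
         * psi_star_inv (\<alpha> / eig_min A * confidence_level \<rho> \<alpha> \<beta> \<epsilon> \<delta> h A))"
    using self_normalized_bound[OF assms(1) filt sub sub_psi] by blast
  have "AE \<omega> in M. \<omega> \<in> space M - B \<longrightarrow> \<omega> \<in> ?G"
    using good
  proof (rule AE_mp, intro AE_I2 impI)
    fix \<omega> assume \<omega>: "\<omega> \<in> space M" "\<omega> \<in> space M - B"
      and h: "\<omega> \<notin> B \<longrightarrow> (\<forall>t A s. transpose A = A \<longrightarrow> \<rho> \<le> eig_min A \<longrightarrow>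
       (\<forall>x. x \<bullet> (V t \<omega> *v x) \<le> x \<bullet> (A *v x)) \<longrightarrow> A *v s = S t \<omega> \<longrightarrow>
       sqrt (s \<bullet> S t \<omega>) < sqrt (eig_min A) / (1 - \<epsilon>)
         * psi_star_inv (\<alpha> / eig_min A * confidence_level \<rho> \<alpha> \<beta> \<epsilon> \<delta> h A))"
    have "norm (mat_sqrt (A t \<omega>) *v (matrix_inv (A t \<omega>) *v (V t \<omega> *v \<theta> + S t \<omega>) - \<theta>))
      < radius (A t \<omega>) + b t \<omega>" for t
    proof -
      let ?A = "A t \<omega>" and ?R = "mat_sqrt (A t \<omega>)"
      let ?s = "matrix_inv ?A *v S t \<omega>" and ?e = "matrix_inv ?A *v ((?A - V t \<omega>) *v \<theta>)"
      have As: "?A *v ?s = S t \<omega>" using matrix_inv_mult_cancel(1)[OF inv[OF \<omega>(1)]] .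
      have "sqrt (?s \<bullet> S t \<omega>) < radius ?A"
        using h \<omega> sym[OF \<omega>(1), of t] ge[OF \<omega>(1), of t] VA[OF \<omega>(1), of _ t] As
        unfolding radius_def by blast
      then have "norm (?R *v ?s) < radius ?A" by (simp add: norm_mat_sqrt[OF psd[OF \<omega>(1)]] As)
      moreover have "matrix_inv ?A *v (V t \<omega> *v \<theta> + S t \<omega>) - \<theta> = ?s - ?e"
        by (simp add: matrix_vector_right_distrib matrix_vector_mult_diff_rdistrib
            matrix_vector_mult_diff_distrib matrix_inv_mult_cancel(2)[OF inv[OF \<omega>(1)]])
      moreover have "norm (?R *v (?s - ?e)) \<le> norm (?R *v ?s) + norm (?R *v ?e)"
        by (simp add: matrix_vector_mult_diff_distrib norm_triangle_ineq4)
      ultimately show ?thesis using bias[OF \<omega>(1), of t] by simp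
    qed
    then show "\<omega> \<in> ?G" using \<omega>(1) by blast
  qed
  then have "measure M (space M - B) \<le> measure M ?G"
    by (rule finite_measure_mono_AE[OF _ meas])
  moreover have "measure M (space M - B) = 1 - measure M B" using B(1) by (rule prob_compl)
  ultimately show ?thesis using B(2) by linarith
qed

theorem theorem5p2:
  fixes M :: "'a measure" and F :: "nat \<Rightarrow> 'a measure"
    and \<theta> :: "real^'n"
    and X :: "nat \<Rightarrow> 'a \<Rightarrow> real^'n"
    and noise Y :: "nat \<Rightarrow> 'a \<Rightarrow> real"
    and lmax :: ereal and \<psi> h :: "real \<Rightarrow> real"
    and \<rho> \<alpha> \<beta> \<epsilon> \<delta> :: real
  assumes "prob_space M"
    and "filtration (space M) F"
    and "\<And>t. subalgebra M (F t)"
    and "\<And>t. t \<ge> 1 \<Longrightarrow> X t \<in> borel_measurable (F (t - 1))"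
    and "\<And>t. t \<ge> 1 \<Longrightarrow> noise t \<in> borel_measurable (F t)"
    and "\<And>t \<omega>. t \<ge> 1 \<Longrightarrow> \<omega> \<in> space M \<Longrightarrow> Y t \<omega> = X t \<omega> \<bullet> \<theta> + noise t \<omega>"
    and "cgf_like lmax \<psi>"
    and "super_gaussian lmax \<psi>"
    and "steep lmax \<psi>"
    and "sub_psi M F lmax \<psi> (weighted_sum noise X) (gram X)"
    and "\<rho> > 0"
    and "\<alpha> > 1"
    and "\<beta> > 1"
    and "0 < \<epsilon>" and "\<epsilon> < 1"
    and "0 < \<delta>" and "\<delta> < 1"
    and "\<And>x. x \<ge> 0 \<Longrightarrow> h x > 0"
    and "mono_on {0..} h"
    and "summable (\<lambda>k::nat. inverse (h (real k)))"
    and "(\<Sum>k::nat. inverse (h (real k))) \<le> 1"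
  shows
    "\<P>(\<omega> in M. \<forall>t\<ge>1.
        norm (mat_sqrt (mat_max (gram X t \<omega>) \<rho>) *v (theta_hat \<rho> X Y t \<omega> - \<theta>))
        < sqrt (eig_min (mat_max (gram X t \<omega>) \<rho>)) / (1 - \<epsilon>)
            * convex_conj_inv lmax \<psi>
                (\<alpha> / eig_min (mat_max (gram X t \<omega>) \<rho>)
                  * log_term \<rho> \<alpha> \<beta> \<epsilon> \<delta> h (gram X t \<omega>))
          + sqrt \<rho> * norm \<theta> * of_bool (eig_min (gram X t \<omega>) < \<rho>)) \<ge> 1 - \<delta>
     \<and>
     \<P>(\<omega> in M. \<forall>t\<ge>1.
        norm (mat_sqrt (gram X t \<omega> + \<rho> *\<^sub>R mat 1) *v (theta_tilde \<rho> X Y t \<omega> - \<theta>))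
        < sqrt (eig_min (gram X t \<omega> + \<rho> *\<^sub>R mat 1)) / (1 - \<epsilon>)
            * convex_conj_inv lmax \<psi>
                (\<alpha> / eig_min (gram X t \<omega> + \<rho> *\<^sub>R mat 1)
                  * log_term \<rho> \<alpha> \<beta> \<epsilon> \<delta> h (gram X t \<omega> + \<rho> *\<^sub>R mat 1))
          + sqrt \<rho> * norm \<theta>) \<ge> 1 - \<delta>"
proof -
  interpret stitching lmax \<psi> \<rho> \<alpha> \<beta> \<epsilon> \<delta> h
    using assms by unfold_locales auto
  let ?S = "weighted_sum noise X" and ?V = "gram X"
  have psd: "psd (?V t \<omega>)" if "\<omega> \<in> space M" for t \<omega>
    using assms(10) that by (auto simp: sub_psi_def)
  then have sym: "transpose (?V t \<omega>) = ?V t \<omega>" if "\<omega> \<in> space M" for t \<omega>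
    using that by (auto simp: psd_def)
  have V_meas [measurable]: "?V t \<in> borel_measurable M" for t
    using assms(10) measurable_from_subalg[OF assms(3)[of t]] unfolding sub_psi_def by auto
  have response: "weighted_sum Y X t \<omega> = ?V t \<omega> *v \<theta> + ?S t \<omega>" if "\<omega> \<in> space M" for t \<omega>
  proof -
    have "weighted_sum Y X t \<omega> = (\<Sum>s=1..t. (X s \<omega> \<bullet> \<theta> + noise s \<omega>) *\<^sub>R X s \<omega>)"
      unfolding weighted_sum_def using assms(6)[OF _ that] by (intro sum.cong) auto
    also have "\<dots> = ?V t \<omega> *v \<theta> + ?S t \<omega>"
      by (simp add: weighted_sum_def gram_def sum_matrix_vector_mult outer_sq_mult
          scaleR_add_left sum.distrib)
    finally show ?thesis .
  qed
  have log_term: "log_term \<rho> \<alpha> \<beta> \<epsilon> \<delta> h W = confidence_level \<rho> \<alpha> \<beta> \<epsilon> \<delta> h (mat_max W \<rho>)" for W :: "real^'n^'n"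
    by (simp add: log_term_def confidence_level_def)
  show ?thesis
  proof
    have "1 - \<delta> \<le> measure M {\<omega>\<in>space M. \<forall>t\<ge>1.
        norm (mat_sqrt (mat_max (?V t \<omega>) \<rho>) *v (matrix_inv (mat_max (?V t \<omega>) \<rho>) *v (?V t \<omega> *v \<theta> + ?S t \<omega>) - \<theta>))
        < radius (mat_max (?V t \<omega>) \<rho>) + sqrt \<rho> * norm \<theta> * of_bool (eig_min (?V t \<omega>) < \<rho>)}"
    proof (rule regularized_confidence_ellipsoid[OF assms(1-3,10)])
      note [measurable] = borel_measurable_eig_min[OF V_meas sym]
      show "(\<lambda>\<omega>. mat_max (?V t \<omega>) \<rho>) \<in> borel_measurable M" for t
        using borel_measurable_mat_max[OF V_meas sym] .
      show "(\<lambda>\<omega>. sqrt \<rho> * norm \<theta> * of_bool (eig_min (?V t \<omega>) < \<rho>)) \<in> borel_measurable M" for t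
        by measurable
      fix t \<omega> assume \<omega>: "\<omega> \<in> space M"
      show "transpose (mat_max (?V t \<omega>) \<rho>) = mat_max (?V t \<omega>) \<rho>"
        and "\<rho> \<le> eig_min (mat_max (?V t \<omega>) \<rho>)"
        and "x \<bullet> (?V t \<omega> *v x) \<le> x \<bullet> (mat_max (?V t \<omega>) \<rho> *v x)" for x
        using transpose_mat_max le_eig_min_mat_max quad_le_quad_mat_max sym[OF \<omega>] by blast+
      show "norm (mat_sqrt (mat_max (?V t \<omega>) \<rho>) *v (matrix_inv (mat_max (?V t \<omega>) \<rho>) *v
          ((mat_max (?V t \<omega>) \<rho> - ?V t \<omega>) *v \<theta>))) \<le> sqrt \<rho> * norm \<theta> * of_bool (eig_min (?V t \<omega>) < \<rho>)"
      proof (cases "eig_min (?V t \<omega>) < \<rho>")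
        case True
        obtain c v where d: "spectral_decomposition (?V t \<omega>) c v"
          using spectral_decomposition_exists[OF sym[OF \<omega>]] .
        have c: "0 \<le> c i" for i
          using psd[OF \<omega>, of t] by (simp add: psd_iff_eig_min eig_min_def eigenvalues_eq_range[OF d])
        have "(max (c i) \<rho> - c i)\<^sup>2 \<le> \<rho> * max (c i) \<rho>" for i
        proof (cases "c i \<le> \<rho>")
          case True
          then have "(\<rho> - c i)\<^sup>2 \<le> \<rho>\<^sup>2" using c[of i] by (intro power_mono) auto
          then show ?thesis using True by (simp add: max_absorb2 power2_eq_square)
        qed (use rho in simp)
        then show ?thesis
          using regularization_bias[OF d spectral_decomposition_mat_max[OF d]] rho True
          by (simp add: less_max_iff_disj)
      next
        case False
        then have "mat_max (?V t \<omega>) \<rho> = ?V t \<omega>" using mat_max_id[OF sym[OF \<omega>]] by simp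
        then show ?thesis using False by simp
      qed
    qed
    also have "{\<omega>\<in>space M. \<forall>t\<ge>1.
        norm (mat_sqrt (mat_max (?V t \<omega>) \<rho>) *v (matrix_inv (mat_max (?V t \<omega>) \<rho>) *v (?V t \<omega> *v \<theta> + ?S t \<omega>) - \<theta>))
        < radius (mat_max (?V t \<omega>) \<rho>) + sqrt \<rho> * norm \<theta> * of_bool (eig_min (?V t \<omega>) < \<rho>)}
      = {\<omega>\<in>space M. \<forall>t\<ge>1.
        norm (mat_sqrt (mat_max (gram X t \<omega>) \<rho>) *v (theta_hat \<rho> X Y t \<omega> - \<theta>))
        < sqrt (eig_min (mat_max (gram X t \<omega>) \<rho>)) / (1 - \<epsilon>)
            * convex_conj_inv lmax \<psi>
                (\<alpha> / eig_min (mat_max (gram X t \<omega>) \<rho>)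
                  * log_term \<rho> \<alpha> \<beta> \<epsilon> \<delta> h (gram X t \<omega>))
          + sqrt \<rho> * norm \<theta> * of_bool (eig_min (gram X t \<omega>) < \<rho>)}"
      unfolding radius_def log_term theta_hat_def using response by (intro Collect_cong conj_cong) auto
    finally show "\<P>(\<omega> in M. \<forall>t\<ge>1.
        norm (mat_sqrt (mat_max (gram X t \<omega>) \<rho>) *v (theta_hat \<rho> X Y t \<omega> - \<theta>))
        < sqrt (eig_min (mat_max (gram X t \<omega>) \<rho>)) / (1 - \<epsilon>)
            * convex_conj_inv lmax \<psi>
                (\<alpha> / eig_min (mat_max (gram X t \<omega>) \<rho>)
                  * log_term \<rho> \<alpha> \<beta> \<epsilon> \<delta> h (gram X t \<omega>))
          + sqrt \<rho> * norm \<theta> * of_bool (eig_min (gram X t \<omega>) < \<rho>)) \<ge> 1 - \<delta>" .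
  next
    let ?A = "\<lambda>t \<omega>. gram X t \<omega> + \<rho> *\<^sub>R mat 1"
    have shift: "x \<bullet> (?A t \<omega> *v x) = x \<bullet> (?V t \<omega> *v x) + \<rho> * (x \<bullet> x)" for t \<omega> x
      by (simp add: matrix_vector_mult_add_rdistrib inner_add_right scaleR_matrix_vector_assoc[symmetric])
    have A_sym: "transpose (?A t \<omega>) = ?A t \<omega>" if "\<omega> \<in> space M" for t \<omega>
      using sym[OF that, of t] by (simp add: transpose_def vec_eq_iff mat_def)
    have A_ge: "\<rho> \<le> eig_min (?A t \<omega>)" if "\<omega> \<in> space M" for t \<omega>
      unfolding le_eig_min_iff[OF A_sym[OF that]] shift using psd[OF that, of t] by (simp add: psd_def)
    have "1 - \<delta> \<le> measure M {\<omega>\<in>space M. \<forall>t\<ge>1.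
        norm (mat_sqrt (?A t \<omega>) *v (matrix_inv (?A t \<omega>) *v (?V t \<omega> *v \<theta> + ?S t \<omega>) - \<theta>))
        < radius (?A t \<omega>) + sqrt \<rho> * norm \<theta>}"
    proof (rule regularized_confidence_ellipsoid[OF assms(1-3,10)])
      show "?A t \<in> borel_measurable M" for t by measurable
      show "(\<lambda>\<omega>. sqrt \<rho> * norm \<theta>) \<in> borel_measurable M" for t :: nat by simp
      fix t \<omega> assume \<omega>: "\<omega> \<in> space M"
      show "transpose (?A t \<omega>) = ?A t \<omega>" "\<rho> \<le> eig_min (?A t \<omega>)" using A_sym[OF \<omega>] A_ge[OF \<omega>] .
      show "x \<bullet> (?V t \<omega> *v x) \<le> x \<bullet> (?A t \<omega> *v x)" for x unfolding shift using rho by simp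
      obtain c v where d: "spectral_decomposition (?V t \<omega>) c v"
        using spectral_decomposition_exists[OF sym[OF \<omega>]] .
      have c: "0 \<le> c i" for i
        using psd[OF \<omega>, of t] by (simp add: psd_iff_eig_min eig_min_def eigenvalues_eq_range[OF d])
      have on: "orthonormal_family v" using d by (simp add: spectral_decomposition_iff)
      have "(\<Sum>i\<in>UNIV. 1 *\<^sub>R outer_sq (v i)) *v x = mat 1 *v x" for x
        unfolding spectral_sum_mult by (simp add: orthonormal_expansion[OF on])
      then have one: "(\<Sum>i\<in>UNIV. outer_sq (v i)) = mat 1" by (simp add: matrix_eq)
      have "(\<Sum>i\<in>UNIV. (c i + \<rho>) *\<^sub>R outer_sq (v i)) = ?A t \<omega>"
        using d by (simp add: spectral_decomposition_iff scaleR_add_left sum.distrib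
            scaleR_right.sum[symmetric] one)
      then have d': "spectral_decomposition (?A t \<omega>) (\<lambda>i. c i + \<rho>) v"
        using on by (simp add: spectral_decomposition_iff)
      show "norm (mat_sqrt (?A t \<omega>) *v (matrix_inv (?A t \<omega>) *v ((?A t \<omega> - ?V t \<omega>) *v \<theta>))) \<le> sqrt \<rho> * norm \<theta>"
      proof (rule regularization_bias[OF d d'])
        fix i
        show "0 < c i + \<rho>" using c[of i] rho by simp
        show "(c i + \<rho> - c i)\<^sup>2 \<le> \<rho> * (c i + \<rho>)" using c[of i] rho by (simp add: power2_eq_square)
      qed
    qed
    also have "{\<omega>\<in>space M. \<forall>t\<ge>1.
        norm (mat_sqrt (?A t \<omega>) *v (matrix_inv (?A t \<omega>) *v (?V t \<omega> *v \<theta> + ?S t \<omega>) - \<theta>))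
        < radius (?A t \<omega>) + sqrt \<rho> * norm \<theta>}
      = {\<omega>\<in>space M. \<forall>t\<ge>1.
        norm (mat_sqrt (gram X t \<omega> + \<rho> *\<^sub>R mat 1) *v (theta_tilde \<rho> X Y t \<omega> - \<theta>))
        < sqrt (eig_min (gram X t \<omega> + \<rho> *\<^sub>R mat 1)) / (1 - \<epsilon>)
            * convex_conj_inv lmax \<psi>
                (\<alpha> / eig_min (gram X t \<omega> + \<rho> *\<^sub>R mat 1)
                  * log_term \<rho> \<alpha> \<beta> \<epsilon> \<delta> h (gram X t \<omega> + \<rho> *\<^sub>R mat 1))
          + sqrt \<rho> * norm \<theta>}"
      unfolding radius_def log_term theta_tilde_def
      using response mat_max_id[OF A_sym A_ge] by (intro Collect_cong conj_cong) auto
    finally show "\<P>(\<omega> in M. \<forall>t\<ge>1.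
        norm (mat_sqrt (gram X t \<omega> + \<rho> *\<^sub>R mat 1) *v (theta_tilde \<rho> X Y t \<omega> - \<theta>))
        < sqrt (eig_min (gram X t \<omega> + \<rho> *\<^sub>R mat 1)) / (1 - \<epsilon>)
            * convex_conj_inv lmax \<psi>
                (\<alpha> / eig_min (gram X t \<omega> + \<rho> *\<^sub>R mat 1)
                  * log_term \<rho> \<alpha> \<beta> \<epsilon> \<delta> h (gram X t \<omega> + \<rho> *\<^sub>R mat 1))
          + sqrt \<rho> * norm \<theta>) \<ge> 1 - \<delta>" .
  qed
qed

end
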